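(* Let $\bm F:\mathbb{R}^n\to\mathbb{R}^n$ be $\mathcal{C}^2$, let $J(\bm x)=\nabla\bm F(\bm x)$ denote its Jacobian, and let $1\le k\le n$. Consider the $k$-GHiSD system in the unknowns $(\bm x,\bm v_1,\dots,\bm v_k)\in(\mathbb{R}^n)^{k+1}$: $$\dot{\bm x}=\Big(I-2\sum_{j=1}^{k}\bm v_j\bm v_j^\top\Big)\bm F(\bm x),\qquad \dot{\bm v}_i=\big(I-\bm v_i\bm v_i^\top\big)J(\bm x)\bm v_i-\sum_{j=1}^{i-1}\bm v_j\bm v_j^\top\big(J(\bm x)+J(\bm x)^\top\big)\bm v_i,\quad i=1,\dots,k.$$ Let $\bm x^*\in\mathbb{R}^n$ and let $\bm v_1^*,\dots,\bm v_k^*\in\mathbb{R}^n$ satisfy $\langle\bm v_j^*,\bm v_i^*\rangle=\delta_{ij}$ for $i,j=1,\dots,k$. Assume that the eigenvalues of $J^*=J(\bm x^* )$ are all real and nonzero and can be ordered as $\lambda_1>\lambda_2>\cdots>\lambda_k>\lambda_{k+1}\ge\cdots\ge\lambda_n$ (counted with algebraic multiplicity), and let $\bm w_j\in\mathbb{R}^n$ be a right eigenvector of $J^*$ for $\lambda_j$, $j=1,\dots,k$. Then $(\bm x^*,\bm v_1^*,\dots,\bm v_k^* )$ is a linearly stable stationary point of the $k$-GHiSD system (i.e. it is a stationary point and all eigenvalues of the Jacobian of the right-hand side of the system with respect to $(\bm x,\bm v_1,\dots,\bm v_k)$, evaluated at this point, have negative real part) if and only if $\bm x^*$ is an index-$k$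 saddle of $\dot{\bm x}=\bm F(\bm x)$ and, for each $i=1,\dots,k$, $\{\bm v_1^*,\dots,\bm v_i^*\}$ is an orthonormal basis of $\mathrm{span}\{\bm w_1,\dots,\bm w_i\}$.
   Context: $\langle\bm x,\bm y\rangle=\bm y^\top\bm x$ is the standard inner product on $\mathbb{R}^n$. For the dynamical system $\dot{\bm x}=\bm F(\bm x)$, a stationary point is a point $\bm x^*$ with $\bm F(\bm x^* )=\bm 0$. It is hyperbolic if no eigenvalue of $J(\bm x^* )$ has zero real part. The unstable subspace $\mathcal{W}^{\mathrm u}(\bm x^* )$ is the real part of the span of the (generalized) eigenvectors of $J(\bm x^* )$ with eigenvalues of positive real part. A hyperbolic stationary point $\bm x^*$ is an index-$k$ saddle ($k$-saddle) if $\dim\mathcal{W}^{\mathrm u}(\bm x^* )=k$, i.e. $J(\bm x^* )$ has exactly $k$ eigenvalues (with multiplicity) with positive real part and none with zero real part. *)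

theory Defs
  imports "HOL-Analysis.Analysis" "HOL-Computational_Algebra.Polynomial"
begin

definition jac :: "(real^'n \<Rightarrow> real^'n) \<Rightarrow> real^'n \<Rightarrow> real^'n^'n" where
  "jac F x = matrix (frechet_derivative F (at x))"

definition C2 :: "(real^'n \<Rightarrow> real^'n) \<Rightarrow> bool" where
  "C2 F \<longleftrightarrow> (\<forall>x. F differentiable (at x)) \<and>
     (\<exists>D :: real^'n \<Rightarrow> ((real^'n) \<Rightarrow>\<^sub>L (real^'n^'n)).
        (\<forall>x. (jac F has_derivative blinfun_apply (D x)) (at x)) \<and> continuous_on UNIV D)"

definition charpoly :: "real^'n^'n \<Rightarrow> real poly" where
  "charpoly A = det (\<chi> i j. (if i = j then [:0, 1:] else 0) - [: A$i$j :])"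

definition ccharpoly :: "real^'n^'n \<Rightarrow> complex poly" where
  "ccharpoly A = map_poly complex_of_real (charpoly A)"

text \<open>Complex eigenvalue of a real linear map (= eigenvalue of its complexification):
  L(u + i w) = \<mu> (u + i w) with u + i w \<noteq> 0.\<close>
definition cx_eigenvalue :: "('a::real_vector \<Rightarrow> 'a) \<Rightarrow> complex \<Rightarrow> bool" where
  "cx_eigenvalue L \<mu> \<longleftrightarrow> (\<exists>u w. (u \<noteq> 0 \<or> w \<noteq> 0) \<and>
      L u = Re \<mu> *\<^sub>R u - Im \<mu> *\<^sub>R w \<and> L w = Im \<mu> *\<^sub>R u + Re \<mu> *\<^sub>R w)"

definition stationary :: "(real^'n \<Rightarrow> real^'n) \<Rightarrow> real^'n \<Rightarrow> bool" where
  "stationary F x \<longleftrightarrow> F x = 0"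

definition hyperbolic :: "(real^'n \<Rightarrow> real^'n) \<Rightarrow> real^'n \<Rightarrow> bool" where
  "hyperbolic F x \<longleftrightarrow> stationary F x \<and>
     (\<forall>z. poly (ccharpoly (jac F x)) z = 0 \<longrightarrow> Re z \<noteq> 0)"

definition index_saddle :: "(real^'n \<Rightarrow> real^'n) \<Rightarrow> nat \<Rightarrow> real^'n \<Rightarrow> bool" where
  "index_saddle F k x \<longleftrightarrow> hyperbolic F x \<and>
     (\<Sum>z\<in>{z. poly (ccharpoly (jac F x)) z = 0 \<and> Re z > 0}. order z (ccharpoly (jac F x))) = k"

text \<open>Right-hand side of the k-GHiSD system. The k direction vectors are indexed by
  a finite linearly ordered type 'k (so k = CARD('k)); v_j v_j^T y = (v_j \<bullet> y) v_j.\<close>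
definition ghisd :: "(real^'n \<Rightarrow> real^'n) \<Rightarrow> (real^'n) \<times> ((real^'n, 'k::{finite,linorder}) vec)
                     \<Rightarrow> (real^'n) \<times> ((real^'n, 'k) vec)" where
  "ghisd F s = (let x = fst s; V = snd s; J = jac F x in
     (F x - 2 *\<^sub>R (\<Sum>j\<in>UNIV. (V$j \<bullet> F x) *\<^sub>R V$j),
      \<chi> i. J *v V$i - (V$i \<bullet> (J *v V$i)) *\<^sub>R V$i
            - (\<Sum>j\<in>{j. j < i}. (V$j \<bullet> ((J + transpose J) *v V$i)) *\<^sub>R V$j)))"

definition lin_stable :: "('a::real_normed_vector \<Rightarrow> 'a) \<Rightarrow> 'a \<Rightarrow> bool" where
  "lin_stable G p \<longleftrightarrow> G p = 0 \<and> G differentiable (at p) \<and>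
     (\<forall>\<mu>. cx_eigenvalue (frechet_derivative G (at p)) \<mu> \<longrightarrow> Re \<mu> < 0)"

definition rank :: "'k::{finite,linorder} \<Rightarrow> nat" where
  "rank i = card {j. j < i} + 1"

definition orthonormal_basis_of :: "'a::real_inner set \<Rightarrow> 'a set \<Rightarrow> bool" where
  "orthonormal_basis_of B S \<longleftrightarrow> B \<subseteq> S \<and> independent B \<and> span B = S \<and>
     (\<forall>x\<in>B. norm x = 1) \<and> pairwise orthogonal B"

end

theory Submission
  imports Defs
begin

text \<open>
  Put \<open>J = jac F xs\<close>. Stationarity means that \<open>F xs = 0\<close> and that each \<open>span {v\<^sub>1, \<dots>, v\<^sub>i}\<close> is \<open>J\<close>-invariant.
  At such a point the linearization is block lower triangular with respect to \<open>x, v\<^sub>1, \<dots>, v\<^sub>k\<close>. Writing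
  \<open>\<mu>\<^sub>i = v\<^sub>i \<bullet> J v\<^sub>i\<close>, the first block has the eigenvalues \<open>-\<mu>\<^sub>i\<close> and those of \<open>J\<close> modulo \<open>span {v\<^sub>1, \<dots>, v\<^sub>k}\<close>,
  and the block of \<open>v\<^sub>i\<close> has the eigenvalues \<open>-(\<mu>\<^sub>i + \<mu>\<^sub>m)\<close> for \<open>m \<le> i\<close> and \<open>\<lambda> - \<mu>\<^sub>i\<close> for the eigenvalues
  \<open>\<lambda>\<close> of \<open>J\<close> modulo \<open>span {v\<^sub>1, \<dots>, v\<^sub>i}\<close>. They are all negative iff the \<open>\<mu>\<^sub>i\<close> are the \<open>k\<close> largest eigenvalues in
  decreasing order and are exactly the positive ones. Only eigenvectors are used, no generalized ones:
  if \<open>w\<^sub>i\<close> were outside \<open>span {v\<^sub>1, \<dots>, v\<^sub>i}\<close>, then \<open>\<mu>\<^sub>1 > \<dots> > \<mu>\<^sub>i > \<lambda>\<^sub>i\<close> would be too many eigenvalues above \<open>\<lambda>\<^sub>i\<close>.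
\<close>

subsection \<open>Complex eigenvalues and the characteristic polynomial\<close>

lemma linear_kernel_dim:
  fixes N :: "'a::euclidean_space \<Rightarrow> 'b::euclidean_space"
  assumes "linear N" "N ` W \<subseteq> W'" "dim W' < dim W"
  shows "\<exists>z\<in>span W. z \<noteq> 0 \<and> N z = 0"
proof (rule ccontr)
  assume "\<not> ?thesis"
  then have "inj_on N (span W)"
    using linear_injective_on_subspace_0[OF assms(1) subspace_span] by auto
  then have "dim (N ` W) = dim W"
    by (rule dim_image_eq[OF assms(1)])
  with dim_subset[OF assms(2)] assms(3) show False by simp
qed

lemma linear_kernel_quotient:
  fixes N :: "'a::euclidean_space \<Rightarrow> 'a"
  assumes "linear N" "subspace W" "N ` W \<subseteq> W" "z \<notin> W" "N z \<in> W"
  shows "\<exists>y. y \<noteq> 0 \<and> N y = 0"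
proof -
  have "dim (insert z W) = dim W + 1"
    using assms(2,4) by (simp add: dim_insert span_eq_iff[THEN iffD2])
  then show ?thesis
    using linear_kernel_dim[of N "insert z W" W] assms by auto
qed

text \<open>The complexified operator \<open>L - \<mu>\<close>, where \<open>(u, w)\<close> stands for \<open>u + i w\<close>.\<close>

definition cx_shift :: "('a::real_vector \<Rightarrow> 'a) \<Rightarrow> complex \<Rightarrow> 'a \<times> 'a \<Rightarrow> 'a \<times> 'a" where
  "cx_shift L \<mu> p = (L (fst p) - Re \<mu> *\<^sub>R fst p + Im \<mu> *\<^sub>R snd p,
                     L (snd p) - Im \<mu> *\<^sub>R fst p - Re \<mu> *\<^sub>R snd p)"

lemma cx_eigenvalue_iff: "cx_eigenvalue L \<mu> \<longleftrightarrow> (\<exists>p. p \<noteq> 0 \<and> cx_shift L \<mu> p = 0)"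
  unfolding cx_eigenvalue_def cx_shift_def
  by (auto simp: prod_eq_iff algebra_simps)

lemma linear_cx_shift: "linear L \<Longrightarrow> linear (cx_shift L \<mu>)"
  unfolding cx_shift_def
  by (intro linearI) (auto simp: linear_add linear_cmul algebra_simps)

lemma cx_eigenvalue_of_real:
  "u \<noteq> 0 \<Longrightarrow> L u = \<nu> *\<^sub>R u \<Longrightarrow> linear L \<Longrightarrow> cx_eigenvalue L (of_real \<nu>)"
  unfolding cx_eigenvalue_def by (rule exI[of _ u], rule exI[of _ 0]) (simp add: linear_0)

lemma cx_eigenvalue_quotient:
  fixes L :: "'a::euclidean_space \<Rightarrow> 'a"
  assumes "linear L" "subspace W" "\<And>x. x \<in> W \<Longrightarrow> L x \<in> W" "p \<notin> W \<times> W"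
    and "cx_shift L \<mu> p \<in> W \<times> W"
  shows "cx_eigenvalue L \<mu>"
  unfolding cx_eigenvalue_iff
proof (rule linear_kernel_quotient)
  show "linear (cx_shift L \<mu>)" by (rule linear_cx_shift[OF assms(1)])
  show "subspace (W \<times> W)" using assms(2) by (simp add: subspace_Times)
  show "cx_shift L \<mu> ` (W \<times> W) \<subseteq> W \<times> W"
  proof (rule image_subsetI)
    fix q assume "q \<in> W \<times> W"
    then have q: "fst q \<in> W" "snd q \<in> W" by auto
    show "cx_shift L \<mu> q \<in> W \<times> W"
      unfolding cx_shift_def mem_Times_iff fst_conv snd_conv
      by (intro conjI subspace_add[OF assms(2)] subspace_diff[OF assms(2)] subspace_scale[OF assms(2)] assms(3) q)
  qed
qed (rule assms)+

lemma poly_det: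
  fixes M :: "('a::comm_ring_1 poly)^'n^'n"
  shows "poly (det M) t = det (\<chi> i j. poly (M$i$j) t)"
  unfolding det_def by (simp add: poly_sum poly_prod)

lemma poly_charpoly: "poly (charpoly A) t = det (mat t - A)"
  unfolding charpoly_def poly_det
  by (rule arg_cong[where f=det]) (simp add: vec_eq_iff mat_def)

lemma map_poly_of_real_mult:
  "map_poly complex_of_real (p * q) = map_poly of_real p * map_poly of_real q"
  by (rule poly_eqI) (simp add: coeff_map_poly coeff_mult)

lemma map_poly_of_real_prod:
  "map_poly complex_of_real (\<Prod>x\<in>A. g x) = (\<Prod>x\<in>A. map_poly of_real (g x))"
  by (induction A rule: infinite_finite_induct) (simp_all add: map_poly_of_real_mult)

lemma map_poly_of_real_sum:
  "map_poly complex_of_real (\<Sum>x\<in>A. g x) = (\<Sum>x\<in>A. map_poly of_real (g x))"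
  by (rule poly_eqI) (simp add: coeff_map_poly coeff_sum)

lemma map_poly_of_real_of_int_mult:
  "map_poly complex_of_real (of_int k * p) = of_int k * map_poly of_real p"
  by (rule poly_eqI) (simp add: coeff_map_poly of_int_poly)

lemma poly_ccharpoly:
  "poly (ccharpoly A) z = det (mat z - (\<chi> i j. complex_of_real (A$i$j)))"
proof -
  have "ccharpoly A = det (\<chi> i j. map_poly complex_of_real ((if i = j then [:0, 1:] else 0) - [: A$i$j :]))"
    unfolding ccharpoly_def charpoly_def det_def
    by (simp add: map_poly_of_real_sum map_poly_of_real_prod map_poly_of_real_of_int_mult)
  then show ?thesis
    unfolding poly_det[symmetric]
    by (simp add: poly_det)
       (rule arg_cong[where f=det], simp add: vec_eq_iff mat_def map_poly_pCons)
qed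

lemma det_eq_0_if_kernel:
  fixes M :: "'a::field^'n^'n"
  assumes "M *v z = 0" "z \<noteq> 0"
  shows "det M = 0"
  using assms invertible_det_nz[of M] matrix_left_invertible_ker[of M] invertible_left_inverse[of M]
  by auto

lemma mat_mult_vec: "mat (t::'a::comm_ring_1) *v u = t *s u"
  by (simp add: vec_eq_iff mat_def matrix_vector_mult_def vector_scalar_mult_def
      if_distrib[of "\<lambda>x. x * _"] sum.delta' cong: if_cong)

lemma charpoly_root_if_eigenvector:
  assumes "A *v u = t *\<^sub>R u" "u \<noteq> 0"
  shows "poly (charpoly A) t = 0"
proof -
  have "(mat t - A) *v u = 0"
    using assms(1) by (simp add: matrix_vector_mult_diff_rdistrib mat_mult_vec scalar_mult_eq_scaleR)
  then show ?thesis using det_eq_0_if_kernel assms(2) unfolding poly_charpoly by blast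
qed

lemma eigenvector_if_charpoly_root:
  fixes A :: "real^'n^'n"
  assumes "poly (charpoly A) t = 0"
  obtains u where "A *v u = t *\<^sub>R u" "u \<noteq> 0"
proof -
  obtain u where u: "(mat t - A) *v u = 0" "u \<noteq> 0"
    using assms invertible_det_nz[of "mat t - A"] matrix_left_invertible_ker[of "mat t - A"]
      invertible_left_inverse[of "mat t - A"]
    unfolding poly_charpoly by auto
  then have "A *v u = t *\<^sub>R u"
    by (simp add: matrix_vector_mult_diff_rdistrib mat_mult_vec scalar_mult_eq_scaleR)
  with u(2) that show thesis by blast
qed

lemma ccharpoly_root_if_cx_eigenvalue:
  fixes A :: "real^'n^'n"
  assumes "cx_eigenvalue ((*v) A) z"
  shows "poly (ccharpoly A) z = 0"
proof -
  obtain u w where uw: "u \<noteq> 0 \<or> w \<noteq> 0" "A *v u = Re z *\<^sub>R u - Im z *\<^sub>R w"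
      "A *v w = Im z *\<^sub>R u + Re z *\<^sub>R w"
    using assms unfolding cx_eigenvalue_def by blast
  define y :: "complex^'n" where "y = (\<chi> i. Complex (u$i) (w$i))"
  have "y \<noteq> 0" using uw(1) by (auto simp: y_def vec_eq_iff complex_eq_iff)
  moreover have "(mat z - (\<chi> i j. complex_of_real (A$i$j))) *v y = 0"
  proof -
    have 1: "(\<Sum>j\<in>UNIV. A$i$j * u$j) = Re z * u$i - Im z * w$i"
      "(\<Sum>j\<in>UNIV. A$i$j * w$j) = Im z * u$i + Re z * w$i" for i
      using arg_cong[OF uw(2), of "\<lambda>x. x$i"] arg_cong[OF uw(3), of "\<lambda>x. x$i"]
      by (simp_all add: matrix_vector_mult_def)
    have 2: "(\<Sum>j\<in>UNIV. complex_of_real (A$i$j) * y$j) = z * y$i" for i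
      by (simp add: complex_eq_iff y_def 1)
    show ?thesis
      by (simp add: matrix_vector_mult_diff_rdistrib mat_mult_vec vec_eq_iff)
         (simp add: matrix_vector_mult_def 2)
  qed
  ultimately show ?thesis unfolding poly_ccharpoly by (rule det_eq_0_if_kernel[rotated])
qed

lemma matrix_mult_add_rdistrib: "(A + B) ** (C :: 'a::semiring_1^'m^'n) = A ** C + B ** C"
  by (simp add: vec_eq_iff matrix_matrix_mult_def distrib_right sum.distrib)

lemma det_mat_plus_rank_one:
  fixes v :: "real^'n"
  assumes "norm v = 1"
  shows "det (mat 1 + (\<chi> i j. c * v$i * v$j)) = 1 + c"
proof -
  obtain k :: 'n where True by blast
  obtain Q where Q: "orthogonal_matrix Q" "Q *v axis k 1 = v"
    using orthogonal_matrix_exists_basis[OF assms] by metis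
  define D :: "real^'n^'n" where "D = (\<chi> i j. if i = j then if i = k then 1 + c else 1 else 0)"
  have Qk: "Q$i$k = v$i" for i
    using arg_cong[OF Q(2), of "\<lambda>x. x$i"] by (simp add: matrix_vector_mul_component inner_axis)
  have QD: "Q ** D = (mat 1 + (\<chi> i j. c * v$i * v$j)) ** Q"
  proof -
    have vQ: "(\<Sum>l\<in>UNIV. v$l * Q$l$j) = (if j = k then 1 else 0)" for j
    proof -
      have "(transpose Q ** Q) $ k $ j = (mat 1 :: real^'n^'n) $ k $ j"
        using Q(1) by (simp add: orthogonal_matrix_def)
      then show ?thesis
        by (simp add: matrix_matrix_mult_def transpose_def Qk mat_def)
    qed
    have "((\<chi> i j. c * v$i * v$j) ** Q)$i$j = c * v$i * (if j = k then 1 else 0)" for i j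
      unfolding vQ[symmetric] by (simp add: matrix_matrix_mult_def sum_distrib_left mult.assoc)
    moreover have "(Q ** D)$i$j = Q$i$j * (if j = k then 1 + c else 1)" for i j
      by (simp add: matrix_matrix_mult_def D_def if_distrib[of "\<lambda>x. _ * x"] sum.delta cong: if_cong)
    ultimately show ?thesis
      by (auto simp: vec_eq_iff matrix_mult_add_rdistrib Qk algebra_simps)
  qed
  have "det Q \<noteq> 0" using det_orthogonal_matrix[OF Q(1)] by auto
  moreover have "det Q * det D = det (mat 1 + (\<chi> i j. c * v$i * v$j)) * det Q"
    using arg_cong[OF QD, of det] by (simp add: det_mul)
  moreover have "det D = 1 + c"
  proof -
    have "det D = (\<Prod>i\<in>UNIV. D$i$i)" by (rule det_diagonal) (simp add: D_def)
    also have "\<dots> = 1 + c" by (simp add: D_def prod.delta)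
    finally show ?thesis .
  qed
  ultimately show ?thesis by simp
qed

text \<open>Deflation moves the root of the eigenvector \<open>v\<close> from \<open>\<lambda>\<close> to \<open>\<lambda> - 1\<close>.\<close>

lemma charpoly_deflation:
  fixes A :: "real^'n^'n"
  assumes "norm v = 1" "A *v v = l *\<^sub>R v"
  shows "charpoly (A - (\<chi> i j. v$i * v$j)) * [:-l, 1:] = charpoly A * [:1 - l, 1:]"
proof (rule poly_eq_poly_eq_iff[THEN iffD1], rule ext)
  fix t :: real
  let ?P = "(\<chi> i j. v$i * v$j) :: real^'n^'n"
  show "poly (charpoly (A - ?P) * [:-l, 1:]) t = poly (charpoly A * [:1 - l, 1:]) t"
  proof (cases "t = l")
    case True
    have "v \<noteq> 0" using assms(1) by auto
    with True show ?thesis using charpoly_root_if_eigenvector[OF assms(2)] by simp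
  next
    case False
    let ?R = "mat 1 + (\<chi> i j. (1 / (t - l)) * v$i * v$j) :: real^'n^'n"
    have Av: "(\<Sum>k\<in>UNIV. A$i$k * v$k) = l * v$i" for i
      using arg_cong[OF assms(2), of "\<lambda>x. x$i"] by (simp add: matrix_vector_mult_def)
    have "(mat t - A) ** (\<chi> i j. (1 / (t - l)) * v$i * v$j) = ?P"
    proof -
      have "((mat t - A) ** (\<chi> i j. (1 / (t - l)) * v$i * v$j))$i$j = v$i * v$j" for i j
      proof -
        have "((mat t - A) ** (\<chi> i j. (1 / (t - l)) * v$i * v$j))$i$j
            = (\<Sum>k\<in>UNIV. (if i = k then t else 0) * v$k - A$i$k * v$k) * (1 / (t - l)) * v$j"
          unfolding sum_distrib_right
          by (simp add: matrix_matrix_mult_def mat_def) (rule sum.cong, auto simp: algebra_simps diff_divide_distrib)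
        also have "\<dots> = (t * v$i - l * v$i) * (1 / (t - l)) * v$j"
          by (simp only: sum_subtractf Av) (simp add: if_distrib[of "\<lambda>x. x * _"] sum.delta' cong: if_cong)
        also have "\<dots> = v$i * v$j" using False by (simp add: field_simps)
        finally show ?thesis .
      qed
      then show ?thesis by (simp add: vec_eq_iff)
    qed
    then have "mat t - (A - ?P) = (mat t - A) ** ?R"
      by (simp add: matrix_add_ldistrib)
    then have "poly (charpoly (A - ?P)) t = poly (charpoly A) t * (1 + 1 / (t - l))"
      unfolding poly_charpoly by (simp only: det_mul det_mat_plus_rank_one[OF assms(1)])
    then show ?thesis using False by (simp add: field_simps)
  qed
qed

text \<open>After deflating along \<open>w\<close> the number \<open>l\<close> is not an eigenvalue any more, whereas it would be one
  if it occurred on the quotient by \<open>W\<close>.\<close>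

lemma simple_eigenvalue_quotient:
  fixes A :: "real^'n^'n"
  assumes "charpoly A \<noteq> 0" "order l (charpoly A) = 1" "subspace W" "\<And>x. x \<in> W \<Longrightarrow> A *v x \<in> W"
    and "w \<in> W" "w \<noteq> 0" "A *v w = l *\<^sub>R w" "A *v u - l *\<^sub>R u \<in> W"
  shows "u \<in> W"
proof (rule ccontr)
  assume "u \<notin> W"
  define v where "v = w /\<^sub>R norm w"
  have v: "norm v = 1" "v \<in> W" "A *v v = l *\<^sub>R v"
    using assms(3,5-7) by (auto simp: v_def subspace_scale matrix_vector_mult_scaleR)
  define B where "B = A - (\<chi> i j. v$i * v$j)"
  have B: "B *v x = A *v x - (v \<bullet> x) *\<^sub>R v" for x
    by (simp add: B_def matrix_vector_mult_diff_rdistrib vec_eq_iff)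
       (simp add: matrix_vector_mult_def inner_vec_def sum_distrib_left mult_ac)
  define N where "N x = B *v x - l *\<^sub>R x" for x
  have "linear N" unfolding N_def
    by (intro linear_compose_sub matrix_vector_mul_linear linear_scale_self)
  moreover have "N ` W \<subseteq> W" "N u \<in> W"
  proof -
    show "N ` W \<subseteq> W" using assms(3,4) v(2) by (auto simp: N_def B subspace_diff subspace_scale)
    have "N u = (A *v u - l *\<^sub>R u) - (v \<bullet> u) *\<^sub>R v" by (simp add: N_def B)
    then show "N u \<in> W" using assms(3,8) v(2) by (simp add: subspace_diff subspace_scale)
  qed
  ultimately obtain y where "y \<noteq> 0" "N y = 0"
    using linear_kernel_quotient[of N W u] assms(3) \<open>u \<notin> W\<close> by blast
  then have root: "poly (charpoly B) l = 0"
    by (intro charpoly_root_if_eigenvector) (auto simp: N_def)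
  have eq: "charpoly B * [:-l, 1:] = charpoly A * [:1 - l, 1:]"
    unfolding B_def by (rule charpoly_deflation[OF v(1,3)])
  have nz2: "charpoly A * [:1 - l, 1:] \<noteq> 0" using assms(1) by (simp del: mult_pCons_right)
  then have "charpoly B \<noteq> 0" using eq by auto
  then have "order l (charpoly B) \<noteq> 0" using root by (simp add: order_root)
  moreover have "order l (charpoly B * [:-l, 1:]) = order l (charpoly B) + 1"
    using nz2 order_power_n_n[of l 1] unfolding eq[symmetric] by (simp add: order_mult del: mult_pCons_right)
  moreover have "order l (charpoly A * [:1 - l, 1:]) = 1 + 0"
    using nz2 assms(2) by (subst order_mult) (auto simp: order_0I simp del: mult_pCons_right)
  ultimately show False using eq by simp
qed

subsection \<open>Operators triangular in an orthonormal frame\<close>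

lemma span_eigenvectors_invariant:
  assumes "linear f" "\<And>j. j \<in> I \<Longrightarrow> f (w j) = l j *\<^sub>R w j" "x \<in> span (w ` I)"
  shows "f x \<in> span (w ` I)"
proof -
  have "f ` (w ` I) \<subseteq> span (w ` I)"
    proof clarify
    fix j assume "j \<in> I"
    then show "f (w j) \<in> span (w ` I)" using assms(2) by (simp add: span_scale span_base)
  qed
  then have "span (f ` w ` I) \<subseteq> span (w ` I)" by (rule span_minimal) simp
  then show ?thesis using assms(3) linear_span_image[OF assms(1)] by blast
qed

locale orthonormal_triangular =
  fixes f :: "'a::euclidean_space \<Rightarrow> 'a" and v :: "'k::{finite,linorder} \<Rightarrow> 'a"
  assumes lin: "linear f"
    and orth: "v j \<bullet> v i = (if i = j then 1 else 0)"
    and tri: "f (v i) \<in> span (v ` {..i})"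
begin

definition mu :: "'k \<Rightarrow> real" where "mu i = v i \<bullet> f (v i)"

text \<open>With the Jacobian of the vector field as \<open>f\<close>, these are the diagonal blocks of the linearized
  saddle dynamics: \<open>reflect\<close> for the position and \<open>diagL i\<close> for the direction \<open>v i\<close>.\<close>

definition reflect :: "'a \<Rightarrow> 'a" where
  "reflect u = f u - 2 *\<^sub>R (\<Sum>j\<in>UNIV. (v j \<bullet> f u) *\<^sub>R v j)"

definition diagL :: "'k \<Rightarrow> 'a \<Rightarrow> 'a" where
  "diagL i u = f u - mu i *\<^sub>R u - (u \<bullet> f (v i) + v i \<bullet> f u) *\<^sub>R v i
     - (\<Sum>j\<in>{..<i}. (v j \<bullet> f u + f (v j) \<bullet> u) *\<^sub>R v j)"

lemma linear_reflect: "linear reflect"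
  unfolding reflect_def
  by (rule linearI)
     (simp_all add: linear_add[OF lin] linear_cmul[OF lin] inner_right_distrib scaleR_left_distrib
       sum.distrib algebra_simps scaleR_sum_right)

lemma linear_diagL: "linear (diagL i)"
  unfolding diagL_def
  by (rule linearI)
     (simp_all add: linear_add[OF lin] linear_cmul[OF lin] inner_right_distrib inner_left_distrib
       scaleR_left_distrib sum.distrib algebra_simps scaleR_sum_right)

lemma inner_span_eq_0:
  assumes "x \<in> span (v ` I)" "j \<notin> I"
  shows "v j \<bullet> x = 0"
  using assms(1)
proof (induction rule: span_induct_alt)
  case (step c y z)
  then have "v j \<bullet> y = 0" using assms(2) by (auto simp: orth)
  with step show ?case by (simp add: inner_right_distrib)
qed simp

lemma span_atMost_decomp:
  assumes "x \<in> span (v ` {..i})"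
  shows "x - (v i \<bullet> x) *\<^sub>R v i \<in> span (v ` {..<i})"
proof -
  have "{..i} = insert i {..<i}" by auto
  then obtain k where k: "x - k *\<^sub>R v i \<in> span (v ` {..<i})"
    using assms by (auto simp: span_breakdown_eq)
  have "v i \<bullet> (x - k *\<^sub>R v i) = 0" by (rule inner_span_eq_0[OF k]) simp
  then have "k = v i \<bullet> x" by (simp add: inner_diff_right orth)
  with k show ?thesis by simp
qed

lemma span_mono_index: "I \<subseteq> I' \<Longrightarrow> x \<in> span (v ` I) \<Longrightarrow> x \<in> span (v ` I')"
  using span_mono[of "v ` I" "v ` I'"] by blast

lemma mem_span: "i \<in> I \<Longrightarrow> v i \<in> span (v ` I)"
  by (simp add: span_base)

lemma f_span:
  assumes "x \<in> span (v ` I)" "\<And>i j. i \<in> I \<Longrightarrow> j \<le> i \<Longrightarrow> j \<in> I"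
  shows "f x \<in> span (v ` I)"
proof -
  have "f (v i) \<in> span (v ` I)" if "i \<in> I" for i
    using tri[of i] by (rule span_mono_index[rotated]) (use that assms(2) in auto)
  then have "span (f ` v ` I) \<subseteq> span (v ` I)" by (intro span_minimal) auto
  then show ?thesis using assms(1) linear_span_image[OF lin] by blast
qed

lemma f_minus_mu:
  assumes "x \<in> span (v ` {..i})"
  shows "f x - mu i *\<^sub>R x \<in> span (v ` {..<i})"
proof -
  define s where "s = x - (v i \<bullet> x) *\<^sub>R v i"
  have s: "s \<in> span (v ` {..<i})" unfolding s_def by (rule span_atMost_decomp[OF assms])
  have x: "x = s + (v i \<bullet> x) *\<^sub>R v i" by (simp add: s_def)
  have "f x - mu i *\<^sub>R x = (f s - mu i *\<^sub>R s) + (v i \<bullet> x) *\<^sub>R (f (v i) - mu i *\<^sub>R v i)"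
    by (subst (1 2) x) (simp add: linear_add[OF lin] linear_cmul[OF lin] algebra_simps)
  moreover have "f s \<in> span (v ` {..<i})" by (rule f_span[OF s]) auto
  moreover have "f (v i) - mu i *\<^sub>R v i \<in> span (v ` {..<i})"
    using span_atMost_decomp[OF tri] by (simp add: mu_def)
  ultimately show ?thesis using s by (simp add: span_add span_diff span_scale)
qed

lemma dim_span_lessThan: "dim (span (v ` {..<i})) < dim (span (v ` {..i}))"
proof -
  have "{..i} = insert i {..<i}" by auto
  moreover have "v i \<notin> span (v ` {..<i})"
    using inner_span_eq_0[of "v i" "{..<i}" i] orth[of i i] by auto
  ultimately show ?thesis by (simp add: dim_insert)
qed

lemma f_eigenvalue_mu: "\<exists>x. x \<noteq> 0 \<and> f x = mu i *\<^sub>R x"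
proof -
  have "\<exists>x\<in>span (span (v ` {..i})). x \<noteq> 0 \<and> f x - mu i *\<^sub>R x = 0"
    using f_minus_mu dim_span_lessThan
    by (intro linear_kernel_dim[where W'="span (v ` {..<i})"] linear_compose_sub lin linear_scale_self) auto
  then show ?thesis by auto
qed

lemma diagL_mod_span: "diagL i u - (f u - mu i *\<^sub>R u) \<in> span (v ` {..i})"
proof -
  have "(u \<bullet> f (v i) + v i \<bullet> f u) *\<^sub>R v i + (\<Sum>j\<in>{..<i}. (v j \<bullet> f u + f (v j) \<bullet> u) *\<^sub>R v j)
      \<in> span (v ` {..i})" (is "?x \<in> _")
    by (intro span_add span_sum span_scale) (auto intro: mem_span)
  moreover have eq: "diagL i u - (f u - mu i *\<^sub>R u) = - ?x" by (simp add: diagL_def)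
  ultimately show ?thesis unfolding eq by (intro span_neg)
qed

lemma diagL_span:
  assumes "i \<le> m" "x \<in> span (v ` {..m})"
  shows "diagL i x \<in> span (v ` {..m})"
proof -
  have "diagL i x = (diagL i x - (f x - mu i *\<^sub>R x)) + (f x - mu i *\<^sub>R x)" by simp
  moreover have "diagL i x - (f x - mu i *\<^sub>R x) \<in> span (v ` {..m})"
    using diagL_mod_span by (rule span_mono_index[rotated]) (use assms(1) in auto)
  moreover have "f x \<in> span (v ` {..m})" by (rule f_span[OF assms(2)]) auto
  ultimately show ?thesis using assms(2) by (metis span_add span_diff span_scale)
qed

lemma f_expansion:
  "f (v i) - mu i *\<^sub>R v i = (\<Sum>j\<in>{..<i}. (v j \<bullet> f (v i) + f (v j) \<bullet> v i) *\<^sub>R v j)"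
proof -
  have "f (v i) - mu i *\<^sub>R v i = (\<Sum>j\<in>{..<i}. (v j \<bullet> (f (v i) - mu i *\<^sub>R v i)) *\<^sub>R v j)"
  proof -
    have "x = (\<Sum>j\<in>{..<i}. (v j \<bullet> x) *\<^sub>R v j)" if "x \<in> span (v ` {..<i})" for x
      using that
    proof (induction rule: span_induct_alt)
      case (step c y z)
      then obtain l where l: "y = v l" "l < i" by auto
      have "(\<Sum>j\<in>{..<i}. (v j \<bullet> (c *\<^sub>R y + z)) *\<^sub>R v j)
          = (\<Sum>j\<in>{..<i}. (if j = l then c *\<^sub>R v l else 0)) + (\<Sum>j\<in>{..<i}. (v j \<bullet> z) *\<^sub>R v j)"
        unfolding sum.distrib[symmetric]
        by (rule sum.cong) (auto simp: l inner_right_distrib orth scaleR_left_distrib)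
      then show ?case using l step by simp
    qed simp
    then show ?thesis using f_minus_mu[OF mem_span, of i i] by blast
  qed
  also have "\<dots> = (\<Sum>j\<in>{..<i}. (v j \<bullet> f (v i) + f (v j) \<bullet> v i) *\<^sub>R v j)"
  proof (rule sum.cong)
    fix j assume "j \<in> {..<i}"
    then have "v i \<bullet> f (v j) = 0" by (intro inner_span_eq_0[OF tri]) auto
    then show "(v j \<bullet> (f (v i) - mu i *\<^sub>R v i)) *\<^sub>R v j = (v j \<bullet> f (v i) + f (v j) \<bullet> v i) *\<^sub>R v j"
      using \<open>j \<in> {..<i}\<close> by (auto simp: inner_diff_right orth inner_commute)
  qed simp
  finally show ?thesis .
qed

lemma diagL_eigenvalue_diff:
  assumes "i < j"
  shows "\<exists>u. u \<noteq> 0 \<and> diagL i u = (mu j - mu i) *\<^sub>R u"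
proof -
  have "diagL i x - (mu j - mu i) *\<^sub>R x \<in> span (v ` {..<j})" if "x \<in> span (v ` {..j})" for x
  proof -
    have "diagL i x - (mu j - mu i) *\<^sub>R x = (diagL i x - (f x - mu i *\<^sub>R x)) + (f x - mu j *\<^sub>R x)"
      by (simp add: algebra_simps)
    moreover have "diagL i x - (f x - mu i *\<^sub>R x) \<in> span (v ` {..<j})"
      using diagL_mod_span by (rule span_mono_index[rotated]) (use assms in auto)
    ultimately show ?thesis using f_minus_mu[OF that] by (metis span_add)
  qed
  then have "\<exists>x\<in>span (span (v ` {..j})). x \<noteq> 0 \<and> diagL i x - (mu j - mu i) *\<^sub>R x = 0"
    using dim_span_lessThan
    by (intro linear_kernel_dim[where W'="span (v ` {..<j})"] linear_compose_sub linear_diagL linear_scale_self) auto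
  then show ?thesis by auto
qed

lemma diagL_eigenvalue_quotient:
  assumes "f w = l *\<^sub>R w" "w \<notin> span (v ` {..i})"
  shows "\<exists>u. u \<noteq> 0 \<and> diagL i u = (l - mu i) *\<^sub>R u"
proof -
  have "\<exists>u. u \<noteq> 0 \<and> diagL i u - (l - mu i) *\<^sub>R u = 0"
  proof (rule linear_kernel_quotient)
    show "linear (\<lambda>u. diagL i u - (l - mu i) *\<^sub>R u)"
      by (intro linear_compose_sub linear_diagL linear_scale_self)
    show "diagL i w - (l - mu i) *\<^sub>R w \<in> span (v ` {..i})"
      using diagL_mod_span[of i w] assms(1) by (simp add: algebra_simps)
  qed (use assms(2) diagL_span[of i i] in \<open>auto simp: span_diff span_scale\<close>)
  then show ?thesis by auto
qed

lemma reflect_mod_span: "reflect u - f u \<in> span (range v)"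
proof -
  have "reflect u - f u = - (2 *\<^sub>R (\<Sum>j\<in>UNIV. (v j \<bullet> f u) *\<^sub>R v j))" by (simp add: reflect_def)
  also have "\<dots> \<in> span (range v)" by (intro span_neg span_scale span_sum) (auto intro: span_base)
  finally show ?thesis .
qed

lemma inner_reflect: "v m \<bullet> reflect u = - (v m \<bullet> f u)"
proof -
  have "v m \<bullet> (\<Sum>j\<in>UNIV. (v j \<bullet> f u) *\<^sub>R v j) = (\<Sum>j\<in>UNIV. if j = m then v m \<bullet> f u else 0)"
    unfolding inner_sum_right by (rule sum.cong) (auto simp: orth)
  then show ?thesis by (simp add: reflect_def inner_diff_right)
qed

lemma span_eqI:
  assumes "x \<in> span (v ` I)" "\<And>m. m \<in> I \<Longrightarrow> v m \<bullet> x = 0"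
  shows "x = 0"
proof -
  have "y \<bullet> x = 0" if "y \<in> span (v ` I)" for y
    using that
  proof (induction rule: span_induct_alt)
    case (step c y z)
    then show ?case using assms(2) by (auto simp: inner_left_distrib)
  qed simp
  then show ?thesis using assms(1) by (metis inner_eq_zero_iff)
qed

lemma reflect_span:
  assumes "u \<in> span (range v)"
  shows "reflect u = - f u"
proof -
  have fu: "f u \<in> span (range v)" by (rule f_span[OF assms]) simp
  have "reflect u + f u = (reflect u - f u) + 2 *\<^sub>R f u" by (simp add: scaleR_2)
  then have "reflect u + f u \<in> span (range v)"
    using reflect_mod_span fu by (metis span_add span_scale)
  then have "reflect u + f u = 0"
    by (rule span_eqI) (simp add: inner_right_distrib inner_reflect)
  then show ?thesis by (simp add: eq_neg_iff_add_eq_0)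
qed

lemma reflect_eigenvalue_quotient:
  assumes "f w = l *\<^sub>R w" "w \<notin> span (range v)"
  shows "\<exists>u. u \<noteq> 0 \<and> reflect u = l *\<^sub>R u"
proof -
  have "\<exists>u. u \<noteq> 0 \<and> reflect u - l *\<^sub>R u = 0"
  proof (rule linear_kernel_quotient)
    show "linear (\<lambda>u. reflect u - l *\<^sub>R u)"
      by (intro linear_compose_sub linear_reflect linear_scale_self)
    show "reflect w - l *\<^sub>R w \<in> span (range v)"
      using reflect_mod_span[of w] assms(1) by simp
    show "(\<lambda>u. reflect u - l *\<^sub>R u) ` span (range v) \<subseteq> span (range v)"
      using f_span[of _ UNIV] by (auto simp: reflect_span intro!: span_diff span_scale span_neg)
  qed (use assms(2) in auto)
  then show ?thesis by auto
qed

lemma inner_diagL: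
  assumes "m \<le> i" "\<And>j. j < m \<Longrightarrow> v j \<bullet> u = 0"
  shows "v m \<bullet> diagL i u = - (mu i + mu m) * (v m \<bullet> u)"
proof -
  have "v m \<bullet> diagL i u = - mu i * (v m \<bullet> u) - f (v m) \<bullet> u"
  proof (cases "m = i")
    case True
    have "v i \<bullet> (\<Sum>j\<in>{..<i}. (v j \<bullet> f u + f (v j) \<bullet> u) *\<^sub>R v j) = 0"
      unfolding inner_sum_right by (rule sum.neutral) (auto simp: orth)
    then show ?thesis using True
      by (simp add: diagL_def inner_diff_right orth inner_commute)
  next
    case False
    have "v m \<bullet> (\<Sum>j\<in>{..<i}. (v j \<bullet> f u + f (v j) \<bullet> u) *\<^sub>R v j)
        = (\<Sum>j\<in>{..<i}. if j = m then v m \<bullet> f u + f (v m) \<bullet> u else 0)"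
      unfolding inner_sum_right by (rule sum.cong) (auto simp: orth)
    then show ?thesis using False assms(1)
      by (simp add: diagL_def inner_diff_right orth)
  qed
  moreover have "f (v m) \<bullet> u = mu m * (v m \<bullet> u)"
  proof -
    have "x \<bullet> u = 0" if "x \<in> span (v ` {..<m})" for x
      using that
    proof (induction rule: span_induct_alt)
      case (step c y z)
      then show ?case using assms(2) by (auto simp: inner_left_distrib)
    qed simp
    then have "(f (v m) - mu m *\<^sub>R v m) \<bullet> u = 0" using f_minus_mu[OF mem_span, of m m] by blast
    then show ?thesis by (simp add: inner_diff_left)
  qed
  ultimately show ?thesis by (simp add: algebra_simps)
qed

lemma inner_f_top:
  assumes "u \<in> span (v ` {..m})"
  shows "v m \<bullet> f u = mu m * (v m \<bullet> u)"
  using inner_span_eq_0[OF f_minus_mu[OF assms], of m] by (simp add: inner_diff_right)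

end

lemma cx_real_eigenvalue:
  fixes c d r :: real
  assumes "r * c = Re z * c - Im z * d" "r * d = Im z * c + Re z * d" "c \<noteq> 0 \<or> d \<noteq> 0"
  shows "Re z = r"
proof -
  have "(Re z - r) * (c\<^sup>2 + d\<^sup>2) = c * (Re z * c - Im z * d - r * c) + d * (Im z * c + Re z * d - r * d)"
    by (simp add: power2_eq_square algebra_simps)
  also have "\<dots> = 0" using assms(1,2) by simp
  finally show ?thesis using assms(3) by (auto simp: sum_power2_eq_zero_iff)
qed

context orthonormal_triangular
begin

lemma diagL_cx_eigenvalue_span:
  assumes "p \<noteq> 0" "p \<in> span (v ` {..i}) \<times> span (v ` {..i})" "cx_shift (diagL i) z p = 0"
  obtains m where "m \<le> i" "Re z = - (mu i + mu m)"
proof -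
  obtain a b where p: "p = (a, b)" by (cases p)
  define P where "P m \<longleftrightarrow> m \<le> i \<and> (v m \<bullet> a \<noteq> 0 \<or> v m \<bullet> b \<noteq> 0)" for m
  have "\<exists>m. P m"
    using span_eqI[of a "{..i}"] span_eqI[of b "{..i}"] assms(1,2) by (auto simp: P_def p zero_prod_def)
  then have ne: "{m. P m} \<noteq> {}" by auto
  define m where "m = Min {m. P m}"
  have m: "P m" unfolding m_def using Min_in[OF _ ne] by simp
  have less: "\<not> P j" if "j < m" for j
    using that Min_le[OF finite, of j "{m. P m}"] unfolding m_def by (auto simp: not_le[symmetric])
  have 0: "v j \<bullet> a = 0" "v j \<bullet> b = 0" if "j < m" for j
    using less[OF that] that m by (auto simp: P_def)
  have eqs: "diagL i a = Re z *\<^sub>R a - Im z *\<^sub>R b" "diagL i b = Im z *\<^sub>R a + Re z *\<^sub>R b"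
    using assms(3) by (auto simp: cx_shift_def p zero_prod_def algebra_simps)
  have mi: "m \<le> i" using m by (simp add: P_def)
  have "Re z = - (mu i + mu m)"
  proof (rule cx_real_eigenvalue)
    show "- (mu i + mu m) * (v m \<bullet> a) = Re z * (v m \<bullet> a) - Im z * (v m \<bullet> b)"
      using inner_diagL[OF mi 0(1)] eqs(1) by (simp add: inner_diff_right)
    show "- (mu i + mu m) * (v m \<bullet> b) = Im z * (v m \<bullet> a) + Re z * (v m \<bullet> b)"
      using inner_diagL[OF mi 0(2)] eqs(2) by (simp add: inner_right_distrib)
  qed (use m in \<open>simp add: P_def\<close>)
  then show thesis using that mi by blast
qed

lemma span_atMost_if_top:
  assumes "u \<in> span (range v)" "\<And>j. m < j \<Longrightarrow> v j \<bullet> u = 0"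
  shows "u \<in> span (v ` {..m})"
proof -
  define y where "y = (\<Sum>j\<in>{..m}. (v j \<bullet> u) *\<^sub>R v j)"
  have y: "y \<in> span (v ` {..m})" unfolding y_def by (intro span_sum span_scale mem_span) auto
  have "v l \<bullet> y = (\<Sum>j\<in>{..m}. if j = l then v l \<bullet> u else 0)" for l
    unfolding y_def inner_sum_right by (rule sum.cong) (auto simp: orth)
  then have l: "v l \<bullet> y = v l \<bullet> u" for l using assms(2)[of l] by (simp add: not_le)
  have "u - y = 0"
    by (rule span_eqI[of _ UNIV]) (use assms(1) span_mono_index[OF _ y] l in \<open>auto simp: span_diff inner_diff_right\<close>)
  then show ?thesis using y by simp
qed

lemma reflect_cx_eigenvalue_span:
  assumes "p \<noteq> 0" "p \<in> span (range v) \<times> span (range v)" "cx_shift reflect z p = 0"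
  obtains m where "Re z = - mu m"
proof -
  obtain a b where p: "p = (a, b)" by (cases p)
  define P where "P m \<longleftrightarrow> v m \<bullet> a \<noteq> 0 \<or> v m \<bullet> b \<noteq> 0" for m
  have "\<exists>m. P m"
    using span_eqI[of a UNIV] span_eqI[of b UNIV] assms(1,2) by (auto simp: P_def p zero_prod_def)
  then have ne: "{m. P m} \<noteq> {}" by auto
  define m where "m = Max {m. P m}"
  have m: "P m" unfolding m_def using Max_in[OF _ ne] by simp
  have gr: "\<not> P j" if "m < j" for j
    using that Max_ge[OF finite, of j "{m. P m}"] unfolding m_def by (auto simp: not_le[symmetric])
  have 0: "v j \<bullet> a = 0" "v j \<bullet> b = 0" if "m < j" for j
    using gr[OF that] by (auto simp: P_def)
  have ab: "a \<in> span (v ` {..m})" "b \<in> span (v ` {..m})"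
    using assms(2) 0 by (auto simp: p intro!: span_atMost_if_top)
  have eqs: "reflect a = Re z *\<^sub>R a - Im z *\<^sub>R b" "reflect b = Im z *\<^sub>R a + Re z *\<^sub>R b"
    using assms(3) by (auto simp: cx_shift_def p zero_prod_def algebra_simps)
  have "Re z = - mu m"
  proof (rule cx_real_eigenvalue)
    show "- mu m * (v m \<bullet> a) = Re z * (v m \<bullet> a) - Im z * (v m \<bullet> b)"
      using inner_f_top[OF ab(1)] inner_reflect[of m a] eqs(1) by (simp add: inner_diff_right)
    show "- mu m * (v m \<bullet> b) = Im z * (v m \<bullet> a) + Re z * (v m \<bullet> b)"
      using inner_f_top[OF ab(2)] inner_reflect[of m b] eqs(2) by (simp add: inner_right_distrib)
  qed (use m in \<open>simp add: P_def\<close>)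
  then show thesis using that by blast
qed

lemma diagL_cx_eigenvalue_quotient:
  assumes "cx_shift (diagL i) z p = 0"
  shows "cx_shift f (z + of_real (mu i)) p \<in> span (v ` {..i}) \<times> span (v ` {..i})"
proof -
  have "cx_shift f (z + of_real (mu i)) p =
      - (diagL i (fst p) - (f (fst p) - mu i *\<^sub>R fst p), diagL i (snd p) - (f (snd p) - mu i *\<^sub>R snd p))"
    using assms by (auto simp: cx_shift_def zero_prod_def algebra_simps)
  then show ?thesis using diagL_mod_span[of i] by (simp only: uminus_prod_def mem_Times_iff span_neg fst_conv snd_conv simp_thms)
qed

lemma reflect_cx_eigenvalue_quotient:
  assumes "cx_shift reflect z p = 0"
  shows "cx_shift f z p \<in> span (range v) \<times> span (range v)"
proof -
  have "cx_shift f z p = - (reflect (fst p) - f (fst p), reflect (snd p) - f (snd p))"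
    using assms by (auto simp: cx_shift_def zero_prod_def algebra_simps)
  then show ?thesis using reflect_mod_span by (simp only: uminus_prod_def mem_Times_iff span_neg fst_conv snd_conv simp_thms)
qed

end

subsection \<open>Linearization of the saddle dynamics\<close>

lemma has_derivative_vec_lambda:
  fixes g :: "'k::finite \<Rightarrow> 'a::real_normed_vector \<Rightarrow> 'b::euclidean_space"
  assumes "\<And>i. (g i has_derivative g' i) F"
  shows "((\<lambda>s. \<chi> i. g i s) has_derivative (\<lambda>h. \<chi> i. g' i h)) F"
proof -
  have eq: "(\<chi> i. y i) = (\<Sum>i\<in>UNIV. axis i (y i))" for y :: "'k \<Rightarrow> 'b"
    by (simp add: vec_eq_iff axis_def)
  have "linear (axis i :: 'b \<Rightarrow> 'b^'k)" for i
    by (rule linearI) (auto simp: axis_def vec_eq_iff)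
  then have "bounded_linear (axis i :: 'b \<Rightarrow> 'b^'k)" for i
    by (rule linear_conv_bounded_linear[THEN iffD1])
  then have "((\<lambda>s. axis i (g i s) :: 'b^'k) has_derivative (\<lambda>h. axis i (g' i h))) F" for i
    by (rule bounded_linear.has_derivative) (rule assms)
  then show ?thesis unfolding eq by (rule has_derivative_sum)
qed

lemma bounded_bilinear_matrix_vector_mult:
  "bounded_bilinear ((*v) :: real^'n^'m \<Rightarrow> real^'n \<Rightarrow> real^'m)"
  unfolding bilinear_conv_bounded_bilinear[symmetric] bilinear_def
  by (auto intro!: linearI simp: matrix_vector_right_distrib matrix_vector_mult_add_rdistrib
      matrix_vector_mult_scaleR scaleR_matrix_vector_assoc)

lemma inner_sym_part:
  fixes J :: "real^'n^'n"
  shows "y \<bullet> ((J + transpose J) *v u) = y \<bullet> (J *v u) + (J *v y) \<bullet> u"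
proof -
  have "y \<bullet> (transpose J *v u) = (J *v y) \<bullet> u"
    by (simp add: transpose_matrix_vector) (metis dot_lmul_matrix inner_commute)
  then show ?thesis by (simp add: matrix_vector_mult_add_rdistrib inner_right_distrib)
qed

lemma ghisd_has_derivative:
  fixes F :: "real^'n \<Rightarrow> real^'n" and V :: "(real^'n)^('k::{finite,linorder})"
  assumes "C2 F" "F x = 0"
  defines "J \<equiv> jac F x"
  obtains T where "(ghisd F has_derivative T) (at (x, V))"
    "\<And>h U. fst (T (h, U)) = J *v h - 2 *\<^sub>R (\<Sum>j\<in>UNIV. (V$j \<bullet> (J *v h)) *\<^sub>R V$j)"
    "\<And>i U. (\<And>j. j < i \<Longrightarrow> U$j = 0) \<Longrightarrow> snd (T (0, U)) $ i =
       J *v (U$i) - (V$i \<bullet> (J *v V$i)) *\<^sub>R U$i - (U$i \<bullet> (J *v V$i) + V$i \<bullet> (J *v U$i)) *\<^sub>R V$i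
       - (\<Sum>j\<in>{..<i}. (V$j \<bullet> (J *v U$i) + (J *v V$j) \<bullet> U$i) *\<^sub>R V$j)"
proof -
  obtain D where D: "(jac F has_derivative blinfun_apply (D x)) (at x)"
    using assms(1) unfolding C2_def by blast
  have F: "(F has_derivative (\<lambda>h. J *v h)) (at x)"
  proof -
    have "(F has_derivative frechet_derivative F (at x)) (at x)"
      using assms(1) frechet_derivative_works unfolding C2_def by blast
    moreover from this have "frechet_derivative F (at x) = (\<lambda>h. J *v h)"
      unfolding J_def jac_def by (auto dest: has_derivative_linear simp: matrix_works)
    ultimately show ?thesis by simp
  qed
  have Vi: "((\<lambda>s. snd s $ i) has_derivative (\<lambda>y. snd y $ i)) (at (x, V))" for i
    by (intro bounded_linear.has_derivative[OF bounded_linear_vec_nth] derivative_intros)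
  have Fx: "((\<lambda>s. F (fst s)) has_derivative (\<lambda>y. J *v fst y)) (at (x, V))"
    by (rule has_derivative_compose[of fst fst, OF has_derivative_fst[OF has_derivative_ident]]) (simp add: F)
  have Jx: "((\<lambda>s. jac F (fst s)) has_derivative (\<lambda>y. D x (fst y))) (at (x, V))"
    by (rule has_derivative_compose[of fst fst, OF has_derivative_fst[OF has_derivative_ident]]) (simp add: D)
  define a where "a i s = jac F (fst s) *v (snd s $ i)" for i :: 'k and s :: "(real^'n) \<times> ((real^'n, 'k) vec)"
  define a' where "a' i y = J *v (snd y $ i) + (D x (fst y)) *v (V$i)" for i :: 'k and y :: "(real^'n) \<times> ((real^'n, 'k) vec)"
  have a': "(a i has_derivative a' i) (at (x, V))" for i
    unfolding a_def a'_def
    using bounded_bilinear.FDERIV[OF bounded_bilinear_matrix_vector_mult Jx Vi[of i]] by (simp add: J_def)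
  define g1 where "g1 s = F (fst s) - 2 *\<^sub>R (\<Sum>j\<in>UNIV. (snd s$j \<bullet> F (fst s)) *\<^sub>R snd s$j)"
    for s :: "(real^'n) \<times> ((real^'n, 'k) vec)"
  define g2 where "g2 i s = a i s - (snd s$i \<bullet> a i s) *\<^sub>R snd s$i
     - (\<Sum>j\<in>{..<i}. (snd s$j \<bullet> a i s + a j s \<bullet> snd s$i) *\<^sub>R snd s$j)" for i s
  define T1 where "T1 y = J *v fst y - 2 *\<^sub>R (\<Sum>j\<in>UNIV. (V$j \<bullet> (J *v fst y)) *\<^sub>R V$j)"
    for y :: "(real^'n) \<times> ((real^'n, 'k) vec)"
  define T2 where "T2 i y = a' i y - ((V$i \<bullet> a i (x, V)) *\<^sub>R snd y$i
        + (V$i \<bullet> a' i y + snd y$i \<bullet> a i (x, V)) *\<^sub>R V$i)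
     - (\<Sum>j\<in>{..<i}. (V$j \<bullet> a i (x, V) + a j (x, V) \<bullet> V$i) *\<^sub>R snd y$j
        + (V$j \<bullet> a' i y + snd y$j \<bullet> a i (x, V) + (a j (x, V) \<bullet> snd y$i + a' j y \<bullet> V$i)) *\<^sub>R V$j)" for i y
  have "(g1 has_derivative T1) (at (x, V))"
    unfolding g1_def T1_def
    by (rule derivative_eq_intros Fx Vi refl | simp add: assms(2))+
  moreover have "(g2 i has_derivative T2 i) (at (x, V))" for i
    unfolding g2_def T2_def
    by (rule derivative_eq_intros a' Vi refl | simp)+
  ultimately have "((\<lambda>s. (g1 s, \<chi> i. g2 i s)) has_derivative (\<lambda>y. (T1 y, \<chi> i. T2 i y))) (at (x, V))"
    by (intro has_derivative_Pair has_derivative_vec_lambda)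
  moreover have "ghisd F = (\<lambda>s. (g1 s, \<chi> i. g2 i s))"
    by (rule ext) (simp add: ghisd_def g1_def g2_def a_def Let_def inner_sym_part lessThan_def)
  moreover have "T2 i (0, U) = J *v (U$i) - (V$i \<bullet> (J *v V$i)) *\<^sub>R U$i
       - (U$i \<bullet> (J *v V$i) + V$i \<bullet> (J *v U$i)) *\<^sub>R V$i
       - (\<Sum>j\<in>{..<i}. (V$j \<bullet> (J *v U$i) + (J *v V$j) \<bullet> U$i) *\<^sub>R V$j)"
    if "\<And>j. j < i \<Longrightarrow> U$j = 0" for i U
  proof -
    have "(\<Sum>j\<in>{..<i}. (V$j \<bullet> a i (x, V) + a j (x, V) \<bullet> V$i) *\<^sub>R U$j
        + (V$j \<bullet> a' i (0, U) + U$j \<bullet> a i (x, V) + (a j (x, V) \<bullet> U$i + a' j (0, U) \<bullet> V$i)) *\<^sub>R V$j)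
      = (\<Sum>j\<in>{..<i}. (V$j \<bullet> (J *v U$i) + (J *v V$j) \<bullet> U$i) *\<^sub>R V$j)"
      by (rule sum.cong) (auto simp: that a'_def a_def J_def)
    then show ?thesis
      by (simp add: T2_def) (simp add: a_def a'_def J_def algebra_simps)
  qed
  ultimately show thesis
    by (intro that[of "\<lambda>y. (T1 y, \<chi> i. T2 i y)"]) (simp_all add: T1_def)
qed

text \<open>The two block conditions say that \<open>T\<close> is block lower triangular, in the order \<open>h, U$1, U$2, \<dots>\<close>,
  without mentioning the entries below the diagonal.\<close>

locale block_triangular =
  fixes T :: "'a::euclidean_space \<times> ('a^('k::{finite,linorder})) \<Rightarrow> 'a \<times> (('a, 'k) vec)"
    and A :: "'a \<Rightarrow> 'a" and B :: "'k \<Rightarrow> 'a \<Rightarrow> 'a"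
  assumes lin_T: "linear T" and lin_A: "linear A" and lin_B: "linear (B i)"
    and fst_T: "fst (T (h, U)) = A h"
    and snd_T: "(\<And>j. j < i \<Longrightarrow> U$j = 0) \<Longrightarrow> snd (T (0, U)) $ i = B i (U$i)"
begin

lemma cx_eigenvalue_if_not_inj:
  assumes "\<not> inj (\<lambda>p. T p - t *\<^sub>R p)"
  shows "cx_eigenvalue T (of_real t)"
proof -
  have "linear (\<lambda>p. T p - t *\<^sub>R p)" by (intro linear_compose_sub lin_T linear_scale_self)
  then obtain p where "p \<noteq> 0" "T p = t *\<^sub>R p"
    using assms by (auto simp: linear_injective_0)
  then show ?thesis using lin_T by (intro cx_eigenvalue_of_real)
qed

lemma eigenvalue_A:
  assumes "u \<noteq> 0" "A u = t *\<^sub>R u"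
  shows "cx_eigenvalue T (of_real t)"
proof (rule cx_eigenvalue_if_not_inj, rule notI)
  assume inj: "inj (\<lambda>p. T p - t *\<^sub>R p)"
  have "surj (\<lambda>p. T p - t *\<^sub>R p)"
    by (intro linear_injective_imp_surjective inj linear_compose_sub lin_T linear_scale_self) auto
  have "\<exists>h. y = A h - t *\<^sub>R h" for y
  proof -
    obtain p where p: "(y, 0) = T p - t *\<^sub>R p"
      using \<open>surj (\<lambda>p. T p - t *\<^sub>R p)\<close> unfolding surj_def by blast
    have "y = A (fst p) - t *\<^sub>R fst p"
      using arg_cong[OF p, of fst] fst_T[of "fst p" "snd p"] by simp
    then show ?thesis by blast
  qed
  then have "surj (\<lambda>h. A h - t *\<^sub>R h)" unfolding surj_def by blast
  then have "inj (\<lambda>h. A h - t *\<^sub>R h)"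
    by (intro linear_surjective_imp_injective linear_compose_sub lin_A linear_scale_self) auto
  then show False using assms linear_0[OF lin_A] by (auto dest!: injD[of _ u 0])
qed

lemma eigenvalue_B:
  assumes "u \<noteq> 0" "B i u = t *\<^sub>R u"
  shows "cx_eigenvalue T (of_real t)"
proof (rule cx_eigenvalue_if_not_inj, rule notI)
  let ?N = "\<lambda>p. T p - t *\<^sub>R p"
  assume inj: "inj ?N"
  have lin: "linear ?N" by (intro linear_compose_sub lin_T linear_scale_self)
  define W where "W = {p :: 'a \<times> (('a, 'k) vec). fst p = 0 \<and> (\<forall>j<i. snd p $ j = 0)}"
  have W: "subspace W" by (auto simp: subspace_def W_def)
  have TW: "T p \<in> W" if "p \<in> W" for p
  proof -
    have p: "p = (0, snd p)" using that by (auto simp: W_def prod_eq_iff)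
    have "snd (T (0, snd p)) $ j = 0" if "j < i" for j
      using snd_T[of j "snd p"] \<open>p \<in> W\<close> that linear_0[OF lin_B] by (auto simp: W_def)
    moreover have "fst (T (0, snd p)) = 0" using fst_T linear_0[OF lin_A] by simp
    ultimately show ?thesis using p by (auto simp: W_def)
  qed
  have "?N ` W = W"
  proof (rule subspace_dim_equal)
    show "subspace (?N ` W)" by (rule linear_subspace_image[OF lin W])
    show "?N ` W \<subseteq> W" using TW by (intro image_subsetI subspace_diff[OF W] subspace_scale[OF W])
    have "dim (?N ` W) = dim W" by (rule dim_image_eq[OF lin]) (rule inj_on_subset[OF inj], simp)
    then show "dim W \<le> dim (?N ` W)" by simp
  qed (rule W)
  have "surj (\<lambda>u. B i u - t *\<^sub>R u)"
  proof -
    have "\<exists>u. y = B i u - t *\<^sub>R u" for y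
    proof -
      have "(0, axis i y) \<in> W" by (auto simp: W_def axis_def)
      then obtain p where p: "p \<in> W" "?N p = (0, axis i y)" using \<open>?N ` W = W\<close> by (metis (no_types, lifting) imageE)
      have "p = (0, snd p)" using p(1) by (auto simp: W_def prod_eq_iff)
      then have "snd (T p) $ i = B i (snd p $ i)"
        using snd_T[of i "snd p"] p(1) by (auto simp: W_def)
      moreover have "snd (?N p) $ i = y" unfolding p(2) by (simp add: axis_def)
      ultimately have "B i (snd p $ i) - t *\<^sub>R snd p $ i = y" by simp
      then show ?thesis by blast
    qed
    then show ?thesis by (auto simp: surj_def)
  qed
  then have "inj (\<lambda>h. B i h - t *\<^sub>R h)"
    by (intro linear_surjective_imp_injective linear_compose_sub lin_B linear_scale_self) auto
  then show False using assms linear_0[OF lin_B] by (auto dest!: injD[of _ u 0])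
qed

lemma cx_eigenvalue_cases:
  assumes "cx_eigenvalue T z"
  shows "cx_eigenvalue A z \<or> (\<exists>i. cx_eigenvalue (B i) z)"
proof -
  obtain p q where pq: "p \<noteq> 0 \<or> q \<noteq> 0" "T p = Re z *\<^sub>R p - Im z *\<^sub>R q" "T q = Im z *\<^sub>R p + Re z *\<^sub>R q"
    using assms unfolding cx_eigenvalue_def by blast
  show ?thesis
  proof (cases "fst p = 0 \<and> fst q = 0")
    case False
    moreover have "A (fst p) = Re z *\<^sub>R fst p - Im z *\<^sub>R fst q" "A (fst q) = Im z *\<^sub>R fst p + Re z *\<^sub>R fst q"
      using fst_T[of "fst p" "snd p"] fst_T[of "fst q" "snd q"] pq(2,3) by simp_all
    ultimately show ?thesis unfolding cx_eigenvalue_def by blast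
  next
    case True
    then have p: "p = (0, snd p)" and q: "q = (0, snd q)" by (auto simp: prod_eq_iff)
    define P where "P i \<longleftrightarrow> snd p $ i \<noteq> 0 \<or> snd q $ i \<noteq> 0" for i
    have "\<exists>i. P i" using pq(1) True by (auto simp: P_def prod_eq_iff vec_eq_iff)
    then have ne: "{i. P i} \<noteq> {}" by auto
    define i where "i = Min {i. P i}"
    have i: "P i" unfolding i_def using Min_in[OF _ ne] by simp
    have less: "\<not> P j" if "j < i" for j
      using that Min_le[OF finite, of j "{m. P m}"] unfolding i_def by (auto simp: not_le[symmetric])
    have "snd (T p) $ i = B i (snd p $ i)" "snd (T q) $ i = B i (snd q $ i)"
      using snd_T[of i "snd p"] snd_T[of i "snd q"] less p q by (auto simp: P_def)
    then have "B i (snd p $ i) = Re z *\<^sub>R snd p $ i - Im z *\<^sub>R snd q $ i"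
      "B i (snd q $ i) = Im z *\<^sub>R snd p $ i + Re z *\<^sub>R snd q $ i"
      using pq(2,3) by simp_all
    then show ?thesis using i unfolding cx_eigenvalue_def P_def by blast
  qed
qed

end

subsection \<open>Stability and the ordered spectrum\<close>

lemma eigenvector_in_span_0:
  fixes f :: "'a::real_vector \<Rightarrow> 'a"
  assumes "linear f" "finite I" "\<And>j. j \<in> I \<Longrightarrow> f (w j) = l j *\<^sub>R w j"
    and "x \<in> span (w ` I)" "f x = t *\<^sub>R x" "t \<notin> l ` I"
  shows "x = 0"
  using assms(2,3,4,6)
proof (induction I rule: finite_induct)
  case (insert j I)
  obtain c where s: "x - c *\<^sub>R w j \<in> span (w ` I)" (is "?s \<in> _")
    using insert.prems(2) by (auto simp: span_breakdown_eq)
  have fs: "f ?s \<in> span (w ` I)"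
    by (rule span_eigenvectors_invariant[OF assms(1) _ s]) (use insert.prems(1) in auto)
  have "f ?s - l j *\<^sub>R ?s = (t - l j) *\<^sub>R x"
    using insert.prems(1)[of j] assms(5)
    by (simp add: linear_diff[OF assms(1)] linear_cmul[OF assms(1)] algebra_simps)
  then have "(t - l j) *\<^sub>R x \<in> span (w ` I)"
    using fs s by (metis span_diff span_scale)
  then have "x \<in> span (w ` I)"
    using insert.prems(3) span_scale[of "(t - l j) *\<^sub>R x" "w ` I" "inverse (t - l j)"] by simp
  then show ?case using insert by auto
qed auto

lemma independent_eigenvectors:
  fixes f :: "'a::real_vector \<Rightarrow> 'a"
  assumes "linear f" "finite I" "\<And>j. j \<in> I \<Longrightarrow> f (w j) = l j *\<^sub>R w j" "\<And>j. j \<in> I \<Longrightarrow> w j \<noteq> 0"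
    and "inj_on l I"
  shows "independent (w ` I)" "inj_on w I"
proof -
  have notin: "w j \<notin> span (w ` (I - {j}))" if "j \<in> I" for j
  proof
    assume "w j \<in> span (w ` (I - {j}))"
    moreover have "l j \<notin> l ` (I - {j})" using assms(5) that by (auto dest: inj_onD)
    ultimately have "w j = 0"
      using assms(2,3) that by (intro eigenvector_in_span_0[OF assms(1), of "I - {j}" w l _ "l j"]) auto
    then show False using assms(4) that by blast
  qed
  show inj: "inj_on w I"
  proof (rule inj_onI, rule ccontr)
    fix i j assume ij: "i \<in> I" "j \<in> I" "w i = w j" "i \<noteq> j"
    then have "w j \<in> w ` (I - {i})" by auto
    then have "w i \<in> span (w ` (I - {i}))" unfolding ij(3) by (rule span_base)
    then show False using notin[OF ij(1)] by blast
  qed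
  show "independent (w ` I)"
    unfolding dependent_def
  proof clarify
    fix j assume "j \<in> I" "w j \<in> span (w ` I - {w j})"
    moreover have "w ` I - {w j} = w ` (I - {j})" using inj \<open>j \<in> I\<close> by (auto dest: inj_onD)
    ultimately show False using notin by simp
  qed
qed

lemma order_prod_linear_factors:
  fixes c :: "'b \<Rightarrow> 'a::idom"
  assumes "finite I"
  shows "order z (\<Prod>i\<in>I. [:- c i, 1:]) = card {i\<in>I. c i = z}"
  using assms
proof (induction I rule: finite_induct)
  case (insert j I)
  have nz: "[:- c j, 1:] * (\<Prod>i\<in>I. [:- c i, 1:]) \<noteq> 0"
    using insert.hyps(1) by (simp del: mult_pCons_left)
  have "order z [:- c j, 1:] = (if c j = z then 1 else 0)"
    using order_power_n_n[of z 1] by (auto intro: order_0I)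
  moreover have "{i \<in> insert j I. c i = z} = (if c j = z then {j} else {}) \<union> {i\<in>I. c i = z}" by auto
  ultimately show ?case
    using insert order_mult[OF nz] by (simp del: mult_pCons_left)
qed simp

lemma rank_pos: "1 \<le> rank i" by (simp add: rank_def)

lemma rank_eq_card: "rank (i :: 'k::{finite,linorder}) = card {..i}"
proof -
  have "{..i} = insert i {j. j < i}" by auto
  then show ?thesis by (simp add: rank_def)
qed

lemma rank_less: "i < j \<Longrightarrow> rank i < rank (j :: 'k::{finite,linorder})"
  unfolding rank_eq_card by (rule psubset_card_mono) (auto simp: psubset_eq)

lemma rank_le_card: "rank (i :: 'k::{finite,linorder}) \<le> CARD('k)"
  unfolding rank_eq_card by (rule card_mono) auto

lemma inj_rank: "inj (rank :: 'k::{finite,linorder} \<Rightarrow> nat)"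
  by (rule injI) (metis linorder_neqE nat_neq_iff rank_less)

lemma rank_image_atMost: "rank ` {..i :: 'k::{finite,linorder}} = {1..rank i}"
proof (rule card_subset_eq)
  show "rank ` {..i} \<subseteq> {1..rank i}"
    using rank_pos rank_less by (fastforce simp: le_less)
  show "card (rank ` {..i}) = card {1..rank i}"
    using card_image[OF inj_on_subset[OF inj_rank, of "{..i}"]] by (simp add: rank_eq_card)
qed simp

lemma range_rank: "range (rank :: 'k::{finite,linorder} \<Rightarrow> nat) = {1..CARD('k)}"
proof (rule card_subset_eq)
  show "range (rank :: 'k \<Rightarrow> nat) \<subseteq> {1..CARD('k)}"
    using rank_pos rank_le_card by auto
  show "card (range (rank :: 'k \<Rightarrow> nat)) = card {1..CARD('k)}"
    using card_image[OF inj_rank] by simp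
qed simp

lemma orthonormal_basis_of_iff:
  assumes "\<And>i j. v j \<bullet> v i = (if i = j then 1 else 0)"
  shows "orthonormal_basis_of (v ` I) (span S) \<longleftrightarrow> span (v ` I) = span S"
proof -
  have "pairwise orthogonal (v ` I)"
    using assms by (auto simp: pairwise_def orthogonal_def)
  moreover have "\<forall>x\<in>v ` I. norm x = 1" using assms by (auto simp: norm_eq_1)
  moreover from this have "0 \<notin> v ` I" by force
  ultimately show ?thesis
    using pairwise_orthogonal_independent[of "v ` I"] span_superset[of "v ` I"]
    unfolding orthonormal_basis_of_def by metis
qed

locale ordered_spectrum =
  fixes A :: "real^'n^'n" and lam :: "nat \<Rightarrow> real" and w :: "'k::{finite,linorder} \<Rightarrow> real^'n"
  assumes k_le_n: "CARD('k) \<le> CARD('n)"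
    and eig: "charpoly A = (\<Prod>i\<in>{1..CARD('n)}. [: - lam i, 1 :])"
    and nonzero: "i \<in> {1..CARD('n)} \<Longrightarrow> lam i \<noteq> 0"
    and strict: "1 \<le> i \<Longrightarrow> i \<le> CARD('k) \<Longrightarrow> i + 1 \<le> CARD('n) \<Longrightarrow> lam (i + 1) < lam i"
    and weak: "CARD('k) + 1 \<le> i \<Longrightarrow> i + 1 \<le> CARD('n) \<Longrightarrow> lam (i + 1) \<le> lam i"
    and evec: "w j \<noteq> 0" "A *v w j = lam (rank j) *\<^sub>R w j"
begin

lemma lam_antimono:
  assumes "1 \<le> i" "i \<le> m" "m \<le> CARD('n)"
  shows "lam m \<le> lam i"
  using assms(2,3)
proof (induction m rule: dec_induct)
  case (step m)
  have "lam (m + 1) \<le> lam m"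
    using step assms(1) strict[of m] weak[of m] by (cases "m \<le> CARD('k)") auto
  then show ?case using step by simp
qed simp

lemma lam_strict:
  assumes "1 \<le> i" "i \<le> CARD('k)" "i < m" "m \<le> CARD('n)"
  shows "lam m < lam i"
proof -
  have "lam (i + 1) < lam i" using assms by (intro strict) auto
  moreover have "lam m \<le> lam (i + 1)" using assms by (intro lam_antimono) auto
  ultimately show ?thesis by simp
qed

lemma rank_mem: "rank (i::'k) \<in> {1..CARD('n)}"
  using rank_pos[of i] rank_le_card[of i] k_le_n by auto

lemma lam_eq_rank_iff: "m \<in> {1..CARD('n)} \<Longrightarrow> lam m = lam (rank (i::'k)) \<longleftrightarrow> m = rank i"
proof
  assume m: "m \<in> {1..CARD('n)}" "lam m = lam (rank i)"
  then show "m = rank i"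
    using lam_strict[of "rank i" m] lam_strict[of m "rank i"] rank_pos[of i] rank_le_card[of i] rank_mem[of i]
    by (cases m "rank i" rule: linorder_cases) auto
qed simp

lemma inj_lam_rank: "inj (\<lambda>i::'k. lam (rank i))"
  by (rule injI) (use lam_eq_rank_iff rank_mem inj_rank in \<open>auto dest: injD\<close>)

lemma charpoly_root_iff: "poly (charpoly A) t = 0 \<longleftrightarrow> t \<in> lam ` {1..CARD('n)}"
  by (auto simp: eig poly_prod)

lemma ccharpoly_eq: "ccharpoly A = (\<Prod>i\<in>{1..CARD('n)}. [: - complex_of_real (lam i), 1 :])"
  by (simp add: ccharpoly_def eig map_poly_of_real_prod map_poly_pCons)

lemma ccharpoly_root_iff: "poly (ccharpoly A) z = 0 \<longleftrightarrow> (\<exists>i\<in>{1..CARD('n)}. z = of_real (lam i))"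
  by (auto simp: ccharpoly_eq poly_prod)

lemma order_lam_rank: "order (lam (rank (i::'k))) (charpoly A) = 1"
proof -
  have "{m\<in>{1..CARD('n)}. lam m = lam (rank i)} = {rank i}"
    using lam_eq_rank_iff[of _ i] rank_mem[of i] by auto
  then show ?thesis unfolding eig by (subst order_prod_linear_factors) simp_all
qed

lemma charpoly_nonzero: "charpoly A \<noteq> 0"
  unfolding eig by simp

lemma unstable_count_iff:
  "(\<Sum>z\<in>{z. poly (ccharpoly A) z = 0 \<and> Re z > 0}. order z (ccharpoly A)) = CARD('k)
    \<longleftrightarrow> (\<forall>i::'k. lam (rank i) > 0) \<and> (\<forall>m\<in>{CARD('k)+1..CARD('n)}. lam m < 0)"
proof -
  define P where "P = {m\<in>{1..CARD('n)}. lam m > 0}"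
  let ?Z = "{z. poly (ccharpoly A) z = 0 \<and> Re z > 0}"
  have Z: "?Z = (\<lambda>m. of_real (lam m)) ` P" by (auto simp: ccharpoly_root_iff P_def)
  have finP: "finite P" by (simp add: P_def)
  have "(\<Sum>z\<in>?Z. order z (ccharpoly A)) = (\<Sum>z\<in>?Z. card {m\<in>P. of_real (lam m) = z})"
  proof (rule sum.cong)
    fix z assume "z \<in> ?Z"
    then have "{m\<in>{1..CARD('n)}. of_real (lam m) = z} = {m\<in>P. of_real (lam m) = z}" by (auto simp: P_def)
    then show "order z (ccharpoly A) = card {m\<in>P. of_real (lam m) = z}"
      unfolding ccharpoly_eq by (subst order_prod_linear_factors) simp_all
  qed simp
  also have "\<dots> = card P"
    using sum.image_gen[OF finP, of "\<lambda>_. 1::nat" "\<lambda>m. complex_of_real (lam m)"] Z by simp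
  finally have count: "(\<Sum>z\<in>?Z. order z (ccharpoly A)) = card P" .
  have "card P = CARD('k) \<longleftrightarrow> P = {1..CARD('k)}"
  proof
    assume c: "card P = CARD('k)"
    have "P = {1..card P}"
    proof (rule card_subset_eq[symmetric])
      show "{1..card P} \<subseteq> P"
      proof
        fix i assume i: "i \<in> {1..card P}"
        have "\<not> P \<subseteq> {1..<i}"
          using card_mono[of "{1..<i}" P] i by auto
        then obtain m where "m \<in> P" "m \<notin> {1..<i}" by blast
        then show "i \<in> P" using lam_antimono[of i m] i by (auto simp: P_def)
      qed
    qed (use finP in auto)
    then show "P = {1..CARD('k)}" using c by simp
  qed simp
  also have "\<dots> \<longleftrightarrow> (\<forall>m\<in>{1..CARD('k)}. lam m > 0) \<and> (\<forall>m\<in>{CARD('k)+1..CARD('n)}. lam m < 0)"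
  proof
    assume eq: "P = {1..CARD('k)}"
    have "lam m < 0" if "m \<in> {CARD('k)+1..CARD('n)}" for m
    proof -
      have "m \<notin> P" using that eq by simp
      then show ?thesis using that nonzero[of m] by (auto simp: P_def not_less)
    qed
    then show "(\<forall>m\<in>{1..CARD('k)}. lam m > 0) \<and> (\<forall>m\<in>{CARD('k)+1..CARD('n)}. lam m < 0)"
      using eq by (auto simp: P_def)
  next
    assume "(\<forall>m\<in>{1..CARD('k)}. lam m > 0) \<and> (\<forall>m\<in>{CARD('k)+1..CARD('n)}. lam m < 0)"
    moreover have "m \<le> CARD('k) \<or> m \<in> {CARD('k)+1..CARD('n)}" if "m \<in> P" for m
      using that by (auto simp: P_def)
    ultimately show "P = {1..CARD('k)}" using k_le_n by (force simp: P_def)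
  qed
  finally show ?thesis unfolding count range_rank[symmetric] by simp
qed

lemma index_saddle_iff:
  assumes "jac F x = A"
  shows "index_saddle F CARD('k) x \<longleftrightarrow> F x = 0 \<and>
    (\<forall>i::'k. lam (rank i) > 0) \<and> (\<forall>m\<in>{CARD('k)+1..CARD('n)}. lam m < 0)"
proof -
  have "Re z \<noteq> 0" if "poly (ccharpoly A) z = 0" for z
    using that nonzero by (auto simp: ccharpoly_root_iff)
  then show ?thesis
    unfolding index_saddle_def hyperbolic_def stationary_def assms
    using unstable_count_iff by blast
qed

lemma span_eq_if_mem:
  fixes v :: "'k \<Rightarrow> real^'n"
  assumes "\<And>j. j \<in> I \<Longrightarrow> w j \<in> span (v ` I)"
  shows "span (v ` I) = span (w ` I)"
proof -
  have ind: "independent (w ` I)" "inj_on w I"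
    using independent_eigenvectors[of "(*v) A" I w "\<lambda>i. lam (rank i)"]
      evec inj_on_subset[OF inj_lam_rank] by auto
  have "span (w ` I) = span (v ` I)"
  proof (rule subspace_dim_equal)
    show "span (w ` I) \<subseteq> span (v ` I)" by (rule span_minimal) (use assms in auto)
    have "dim (v ` I) \<le> card I"
      using dim_le_card'[of "v ` I"] card_image_le[of I v] by simp
    also have "\<dots> = dim (w ` I)" using ind by (simp add: dim_eq_card_independent card_image)
    finally show "dim (span (v ` I)) \<le> dim (span (w ` I))" by simp
  qed simp_all
  then show ?thesis by simp
qed

lemma cx_eigenvalue_mod_span:
  fixes I :: "'k set"
  assumes "cx_shift ((*v) A) z p \<in> span (w ` I) \<times> span (w ` I)" "p \<notin> span (w ` I) \<times> span (w ` I)"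
  obtains m where "m \<in> {1..CARD('n)} - rank ` I" "z = of_real (lam m)"
proof -
  have inv: "A *v x \<in> span (w ` I)" if "x \<in> span (w ` I)" for x
    by (rule span_eigenvectors_invariant[OF matrix_vector_mul_linear evec(2) that])
  have "cx_eigenvalue ((*v) A) z"
    using assms inv by (intro cx_eigenvalue_quotient[where W="span (w ` I)"]) auto
  then obtain m where m: "m \<in> {1..CARD('n)}" "z = of_real (lam m)"
    using ccharpoly_root_if_cx_eigenvalue ccharpoly_root_iff by blast
  have "m \<notin> rank ` I"
  proof
    assume "m \<in> rank ` I"
    then obtain j where j: "j \<in> I" "m = rank j" by auto
    have mem: "x \<in> span (w ` I)" if "A *v x - lam m *\<^sub>R x \<in> span (w ` I)" for x
      unfolding j(2)
    proof (rule simple_eigenvalue_quotient[OF charpoly_nonzero order_lam_rank subspace_span inv])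
      show "w j \<in> span (w ` I)" using j(1) by (simp add: span_base)
      show "A *v x - lam (rank j) *\<^sub>R x \<in> span (w ` I)" using that j(2) by simp
    qed (use evec in auto)
    have "cx_shift ((*v) A) z p = (A *v fst p - lam m *\<^sub>R fst p, A *v snd p - lam m *\<^sub>R snd p)"
      by (simp add: cx_shift_def m(2))
    then have "A *v fst p - lam m *\<^sub>R fst p \<in> span (w ` I)" "A *v snd p - lam m *\<^sub>R snd p \<in> span (w ` I)"
      using assms(1) by (simp_all add: mem_Times_iff)
    from this[THEN mem] show False using assms(2) by (simp add: mem_Times_iff)
  qed
  with m that show thesis by blast
qed

end

lemma ghisd_eq_0_imp:
  fixes F :: "real^'n \<Rightarrow> real^'n" and V :: "(real^'n)^('k::{finite,linorder})"
  assumes "\<And>i j. V$j \<bullet> V$i = (if i = j then 1 else 0)" "ghisd F (x, V) = 0"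
  shows "F x = 0" "jac F x *v V$i \<in> span ((\<lambda>j. V$j) ` {..i})"
proof -
  have F: "F x = 2 *\<^sub>R (\<Sum>j\<in>UNIV. (V$j \<bullet> F x) *\<^sub>R V$j)"
    using assms(2) by (simp add: ghisd_def Let_def zero_prod_def)
  have "V$m \<bullet> F x = 0" for m
  proof -
    have "V$m \<bullet> (\<Sum>j\<in>UNIV. (V$j \<bullet> F x) *\<^sub>R V$j) = (\<Sum>j\<in>UNIV. if j = m then V$m \<bullet> F x else 0)"
      unfolding inner_sum_right by (rule sum.cong) (auto simp: assms(1))
    then have "V$m \<bullet> F x = 2 * (V$m \<bullet> F x)"
      using arg_cong[OF F, of "\<lambda>y. V$m \<bullet> y"] by simp
    then show ?thesis by simp
  qed
  with F show "F x = 0" by simp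
  define c where "c j = V$j \<bullet> ((jac F x + transpose (jac F x)) *v V$i)" for j
  have "jac F x *v V$i = (V$i \<bullet> (jac F x *v V$i)) *\<^sub>R V$i + (\<Sum>j\<in>{j. j < i}. c j *\<^sub>R V$j)"
  proof -
    have "jac F x *v V$i - (V$i \<bullet> (jac F x *v V$i)) *\<^sub>R V$i - (\<Sum>j\<in>{j. j < i}. c j *\<^sub>R V$j) = 0"
      using arg_cong[OF assms(2), of "\<lambda>p. snd p $ i"] by (simp add: ghisd_def Let_def c_def)
    then show ?thesis by (simp only: diff_eq_eq add_0_left add.commute)
  qed
  moreover have "\<dots> \<in> span ((\<lambda>j. V$j) ` {..i})"
    by (intro span_add span_sum span_scale span_base) auto
  ultimately show "jac F x *v V$i \<in> span ((\<lambda>j. V$j) ` {..i})" by simp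
qed

locale ghisd_stationary = orthonormal_triangular "(*v) (jac F x)" "\<lambda>i. V$i"
  for F :: "real^'n \<Rightarrow> real^'n" and x :: "real^'n" and V :: "(real^'n)^('k::{finite,linorder})" +
  assumes C2: "C2 F" and F0: "F x = 0"
begin

lemma ghisd_0: "ghisd F (x, V) = 0"
proof -
  have "jac F x *v V$i - (V$i \<bullet> (jac F x *v V$i)) *\<^sub>R V$i
      - (\<Sum>j\<in>{j. j < i}. (V$j \<bullet> ((jac F x + transpose (jac F x)) *v V$i)) *\<^sub>R V$j) = 0" for i
    using f_expansion[of i] by (simp add: inner_sym_part lessThan_def mu_def)
  then show ?thesis by (simp add: ghisd_def Let_def F0 zero_prod_def vec_eq_iff[of _ 0])
qed

lemma derivative_block_triangular:
  obtains T where "(ghisd F has_derivative T) (at (x, V))" "block_triangular T reflect diagL"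
proof (rule ghisd_has_derivative[OF C2 F0, of V])
  fix T
  assume T: "(ghisd F has_derivative T) (at (x, V))"
    "\<And>h U. fst (T (h, U)) = jac F x *v h - 2 *\<^sub>R (\<Sum>j\<in>UNIV. (V$j \<bullet> (jac F x *v h)) *\<^sub>R V$j)"
    "\<And>i U. (\<And>j. j < i \<Longrightarrow> U$j = 0) \<Longrightarrow> snd (T (0, U)) $ i =
       jac F x *v (U$i) - (V$i \<bullet> (jac F x *v V$i)) *\<^sub>R U$i
       - (U$i \<bullet> (jac F x *v V$i) + V$i \<bullet> (jac F x *v U$i)) *\<^sub>R V$i
       - (\<Sum>j\<in>{..<i}. (V$j \<bullet> (jac F x *v U$i) + (jac F x *v V$j) \<bullet> U$i) *\<^sub>R V$j)"
  have "block_triangular T reflect diagL"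
  proof (rule block_triangular.intro)
    show "fst (T (h, U)) = reflect h" for h U
      unfolding reflect_def by (rule T(2))
    show "snd (T (0, U)) $ i = diagL i (U$i)" if "\<And>j. j < i \<Longrightarrow> U$j = 0" for i U
      unfolding diagL_def mu_def by (rule T(3)[OF that])
  qed (use T(1) linear_reflect linear_diagL in \<open>auto dest: has_derivative_linear\<close>)
  with T(1) that show thesis by blast
qed

lemma lin_stable_iff:
  "lin_stable (ghisd F) (x, V) \<longleftrightarrow>
    (\<forall>z. cx_eigenvalue (frechet_derivative (ghisd F) (at (x, V))) z \<longrightarrow> Re z < 0)"
  using derivative_block_triangular ghisd_0 unfolding lin_stable_def
  by (metis differentiableI)

lemma stable_imp_eigenvalue_neg:
  assumes "lin_stable (ghisd F) (x, V)"
  shows "u \<noteq> 0 \<Longrightarrow> reflect u = t *\<^sub>R u \<Longrightarrow> t < 0" "u \<noteq> 0 \<Longrightarrow> diagL i u = t *\<^sub>R u \<Longrightarrow> t < 0"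
proof -
  obtain T where T: "(ghisd F has_derivative T) (at (x, V))" "block_triangular T reflect diagL"
    by (rule derivative_block_triangular)
  interpret block_triangular T reflect diagL by (rule T(2))
  have "t < 0" if "cx_eigenvalue T (of_real t)" for t
    using assms that frechet_derivative_at[OF T(1)] unfolding lin_stable_iff by force
  then show "u \<noteq> 0 \<Longrightarrow> reflect u = t *\<^sub>R u \<Longrightarrow> t < 0" "u \<noteq> 0 \<Longrightarrow> diagL i u = t *\<^sub>R u \<Longrightarrow> t < 0"
    using eigenvalue_A eigenvalue_B by blast+
qed

lemma stable_if_cx_eigenvalue_neg:
  assumes "\<And>z. cx_eigenvalue reflect z \<Longrightarrow> Re z < 0" "\<And>i z. cx_eigenvalue (diagL i) z \<Longrightarrow> Re z < 0"
  shows "lin_stable (ghisd F) (x, V)"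
proof -
  obtain T where T: "(ghisd F has_derivative T) (at (x, V))" "block_triangular T reflect diagL"
    by (rule derivative_block_triangular)
  interpret block_triangular T reflect diagL by (rule T(2))
  show ?thesis
    unfolding lin_stable_iff frechet_derivative_at[OF T(1), symmetric]
    using cx_eigenvalue_cases assms by blast
qed

end

locale ghisd_spectrum = ghisd_stationary F x V + ordered_spectrum "jac F x" lam w
  for F :: "real^'n \<Rightarrow> real^'n" and x :: "real^'n" and V :: "(real^'n)^('k::{finite,linorder})"
    and lam :: "nat \<Rightarrow> real" and w :: "'k \<Rightarrow> real^'n"
begin

lemma stable_imp_mem_span:
  assumes "lin_stable (ghisd F) (x, V)"
  shows "w i \<in> span ((\<lambda>j. V$j) ` {..i})"
proof (rule ccontr)
  note neg = stable_imp_eigenvalue_neg[OF assms]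
  assume "w i \<notin> span ((\<lambda>j. V$j) ` {..i})"
  then have less: "lam (rank i) < mu i"
    using diagL_eigenvalue_quotient[OF evec(2)] neg(2) by fastforce
  have mu_less: "mu j < mu l" if "l < j" for l j
    using diagL_eigenvalue_diff[OF that] neg(2) by fastforce
  have "inj_on mu {..i}"
    by (rule inj_onI) (metis less_irrefl linorder_neqE mu_less)
  then have rank: "rank i = card (mu ` {..i})" by (simp add: card_image rank_eq_card)
  have "mu ` {..i} \<subseteq> lam ` {1..<rank i}"
  proof (rule image_subsetI)
    fix j assume "j \<in> {..i}"
    then have j: "mu i \<le> mu j" using mu_less[of j i] by (cases "j = i") (auto simp: le_less)
    obtain m where m: "m \<in> {1..CARD('n)}" "mu j = lam m"
      using f_eigenvalue_mu[of j] charpoly_root_if_eigenvector charpoly_root_iff by blast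
    have "m < rank i"
      using lam_antimono[of "rank i" m] rank_pos[of i] m j less by (force simp: not_less[symmetric])
    then show "mu j \<in> lam ` {1..<rank i}" using m by auto
  qed
  then have "card (mu ` {..i}) \<le> card (lam ` {1..<rank i})" by (intro card_mono) auto
  also have "\<dots> \<le> card {1..<rank i}" by (rule card_image_le) simp
  finally show False using rank rank_pos[of i] by simp
qed

lemma stable_imp_span_eq:
  assumes "lin_stable (ghisd F) (x, V)"
  shows "span ((\<lambda>j. V$j) ` {..i}) = span (w ` {..i})"
proof (rule span_eq_if_mem)
  fix j assume "j \<in> {..i}"
  then show "w j \<in> span ((\<lambda>j. V$j) ` {..i})"
    by (intro span_mono_index[OF _ stable_imp_mem_span[OF assms]]) auto
qed

lemma stable_imp_signs:
  assumes "lin_stable (ghisd F) (x, V)"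
  shows "lam (rank (i::'k)) > 0" and "m \<in> {CARD('k)+1..CARD('n)} \<Longrightarrow> lam m < 0"
proof -
  note neg = stable_imp_eigenvalue_neg[OF assms]
  have mem: "w j \<in> span (range (\<lambda>j. V$j))" for j
    by (rule span_mono_index[OF _ stable_imp_mem_span[OF assms]]) simp
  then have "reflect (w i) = (- lam (rank i)) *\<^sub>R w i"
    using reflect_span evec(2) by simp
  then show "lam (rank i) > 0" using neg(1) evec(1) by fastforce
  assume m: "m \<in> {CARD('k)+1..CARD('n)}"
  show "lam m < 0"
  proof (rule ccontr)
    assume "\<not> lam m < 0"
    then have pos: "lam m > 0" using nonzero[of m] m by simp
    obtain u where u: "jac F x *v u = lam m *\<^sub>R u" "u \<noteq> 0"
      using eigenvector_if_charpoly_root[of "jac F x" "lam m"] charpoly_root_iff m by auto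
    have "u \<in> span (range (\<lambda>j. V$j))"
      using reflect_eigenvalue_quotient[OF u(1)] neg(1) pos by fastforce
    then have "u \<in> span (range w)" using span_eq_if_mem[of UNIV] mem by auto
    moreover have "lam m \<notin> range (\<lambda>i::'k. lam (rank i))"
    proof
      assume "lam m \<in> range (\<lambda>i::'k. lam (rank i))"
      then obtain i :: 'k where "lam m = lam (rank i)" by auto
      then show False using lam_eq_rank_iff[of m i] rank_le_card[of i] m by simp
    qed
    ultimately have "u = 0"
      using evec(2) u(1)
      by (intro eigenvector_in_span_0[of "(*v) (jac F x)" UNIV w "\<lambda>i. lam (rank i)"]) auto
    with u(2) show False by simp
  qed
qed

lemma mu_eq:
  assumes "\<And>i. span ((\<lambda>j. V$j) ` {..i}) = span (w ` {..i})"
  shows "mu i = lam (rank i)"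
proof -
  let ?N = "\<lambda>y. jac F x *v y - lam (rank i) *\<^sub>R y"
  have lin_N: "linear ?N" by (intro linear_compose_sub lin linear_scale_self)
  have "?N (w j) \<in> span ((\<lambda>j. V$j) ` {..<i})" if "j \<le> i" for j
  proof (cases "j = i")
    case True
    then show ?thesis using evec(2) by (simp add: span_zero)
  next
    case False
    have "w j \<in> span ((\<lambda>j. V$j) ` {..j})" unfolding assms by (simp add: span_base)
    then have "w j \<in> span ((\<lambda>j. V$j) ` {..<i})"
      by (rule span_mono_index[rotated]) (use False that in auto)
    then show ?thesis using evec(2) by (auto intro!: span_diff span_scale)
  qed
  then have "span (?N ` w ` {..i}) \<subseteq> span ((\<lambda>j. V$j) ` {..<i})" by (intro span_minimal) auto
  then have "?N ` span (w ` {..i}) \<subseteq> span ((\<lambda>j. V$j) ` {..<i})" using linear_span_image[OF lin_N] by simp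
  moreover have "V$i \<in> span (w ` {..i})" unfolding assms[symmetric] by (rule mem_span) simp
  ultimately have "?N (V$i) \<in> span ((\<lambda>j. V$j) ` {..<i})" by blast
  then have "V$i \<bullet> ?N (V$i) = 0" by (rule inner_span_eq_0) simp
  then show ?thesis using orth[of i i] by (simp add: mu_def inner_diff_right)
qed

lemma stable_if_span_eq:
  assumes span: "\<And>i. span ((\<lambda>j. V$j) ` {..i}) = span (w ` {..i})"
    and pos: "\<And>i::'k. lam (rank i) > 0" and neg: "\<And>m. m \<in> {CARD('k)+1..CARD('n)} \<Longrightarrow> lam m < 0"
  shows "lin_stable (ghisd F) (x, V)"
proof (rule stable_if_cx_eigenvalue_neg)
  note mu = mu_eq[OF span]
  have span_range: "span (range (\<lambda>j. V$j)) = span (range w)"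
  proof (rule span_eq_if_mem)
    fix j :: 'k
    have "w j \<in> span ((\<lambda>j. V$j) ` {..j})" unfolding span by (simp add: span_base)
    then show "w j \<in> span (range (\<lambda>j. V$j))" by (rule span_mono_index[rotated]) simp
  qed
  show "Re z < 0" if z: "cx_eigenvalue reflect z" for z
  proof -
    obtain p where p: "p \<noteq> 0" "cx_shift reflect z p = 0" using z cx_eigenvalue_iff by blast
    show ?thesis
    proof (cases "p \<in> span (range (\<lambda>j. V$j)) \<times> span (range (\<lambda>j. V$j))")
      case True
      then show ?thesis using reflect_cx_eigenvalue_span[OF p(1) _ p(2)] mu pos by force
    next
      case False
      obtain m where "m \<in> {1..CARD('n)} - range (rank :: 'k \<Rightarrow> nat)" "z = of_real (lam m)"
        by (rule cx_eigenvalue_mod_span[OF reflect_cx_eigenvalue_quotient[OF p(2), unfolded span_range]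
              False[unfolded span_range]])
      then show ?thesis using neg[of m] by (auto simp: range_rank)
    qed
  qed
  show "Re z < 0" if z: "cx_eigenvalue (diagL i) z" for i z
  proof -
    obtain p where p: "p \<noteq> 0" "cx_shift (diagL i) z p = 0" using z cx_eigenvalue_iff by blast
    show ?thesis
    proof (cases "p \<in> span ((\<lambda>j. V$j) ` {..i}) \<times> span ((\<lambda>j. V$j) ` {..i})")
      case True
      then obtain m where "Re z = - (mu i + mu m)" using diagL_cx_eigenvalue_span[OF p(1) _ p(2)] by blast
      then show ?thesis using pos[of i] pos[of m] by (simp add: mu)
    next
      case False
      obtain m where m: "m \<in> {1..CARD('n)} - rank ` {..i}" "z + of_real (mu i) = of_real (lam m)"
        by (rule cx_eigenvalue_mod_span[OF diagL_cx_eigenvalue_quotient[OF p(2), unfolded span]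
              False[unfolded span]])
      have "lam m < lam (rank i)"
        using m(1) rank_pos[of i] rank_le_card[of i] unfolding rank_image_atMost by (intro lam_strict) auto
      moreover have "Re z + mu i = lam m" using arg_cong[OF m(2), of Re] by simp
      ultimately show ?thesis by (simp add: mu)
    qed
  qed
qed

end

theorem theorem1:
  fixes F :: "real^'n \<Rightarrow> real^'n"
    and xs :: "real^'n"
    and Vs :: "real^'n^('k::{finite,linorder})"
    and lam :: "nat \<Rightarrow> real"
    and w :: "'k \<Rightarrow> real^'n"
  assumes C2: "C2 F"
    and k_le_n: "CARD('k) \<le> CARD('n)"
    and orth: "\<forall>i j. Vs$j \<bullet> Vs$i = (if i = j then 1 else 0)"
    and eig: "charpoly (jac F xs) = (\<Prod>i\<in>{1..CARD('n)}. [: - lam i, 1 :])"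
    and nonzero: "\<forall>i\<in>{1..CARD('n)}. lam i \<noteq> 0"
    and strict: "\<forall>i. 1 \<le> i \<and> i \<le> CARD('k) \<and> i + 1 \<le> CARD('n) \<longrightarrow> lam i > lam (i + 1)"
    and weak: "\<forall>i. CARD('k) + 1 \<le> i \<and> i + 1 \<le> CARD('n) \<longrightarrow> lam i \<ge> lam (i + 1)"
    and evec: "\<forall>j. w j \<noteq> 0 \<and> jac F xs *v w j = lam (rank j) *\<^sub>R w j"
  shows "lin_stable (ghisd F) (xs, Vs) \<longleftrightarrow>
           (index_saddle F CARD('k) xs \<and>
            (\<forall>i. orthonormal_basis_of ((\<lambda>j. Vs$j) ` {j. j \<le> i}) (span (w ` {j. j \<le> i}))))"
proof -
  interpret ordered_spectrum "jac F xs" lam w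
    by unfold_locales (use k_le_n eig nonzero strict weak evec in auto)
  let ?spans = "\<forall>i. span ((\<lambda>j. Vs$j) ` {..i}) = span (w ` {..i})"
  have rhs: "index_saddle F CARD('k) xs \<and>
      (\<forall>i. orthonormal_basis_of ((\<lambda>j. Vs$j) ` {j. j \<le> i}) (span (w ` {j. j \<le> i})))
    \<longleftrightarrow> F xs = 0 \<and> (\<forall>i::'k. lam (rank i) > 0) \<and> (\<forall>m\<in>{CARD('k)+1..CARD('n)}. lam m < 0) \<and> ?spans"
    using orth by (simp add: index_saddle_iff orthonormal_basis_of_iff atMost_def)
  have spectrum: "ghisd_spectrum F xs Vs lam w"
    if "F xs = 0" "\<And>i. jac F xs *v Vs$i \<in> span ((\<lambda>j. Vs$j) ` {..i})"
    by unfold_locales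
       (use orth C2 that in \<open>auto simp: matrix_vector_right_distrib matrix_vector_mult_scaleR\<close>)
  show ?thesis
    unfolding rhs
  proof
    assume stable: "lin_stable (ghisd F) (xs, Vs)"
    then have "ghisd F (xs, Vs) = 0" by (simp add: lin_stable_def)
    then have F0: "F xs = 0" and tri: "\<And>i. jac F xs *v Vs$i \<in> span ((\<lambda>j. Vs$j) ` {..i})"
      using ghisd_eq_0_imp[of Vs F xs] orth by auto
    interpret ghisd_spectrum F xs Vs lam w by (rule spectrum[OF F0 tri])
    show "F xs = 0 \<and> (\<forall>i::'k. lam (rank i) > 0) \<and> (\<forall>m\<in>{CARD('k)+1..CARD('n)}. lam m < 0) \<and> ?spans"
      using F0 stable_imp_signs[OF stable] stable_imp_span_eq[OF stable] by blast
  next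
    assume R: "F xs = 0 \<and> (\<forall>i::'k. lam (rank i) > 0) \<and> (\<forall>m\<in>{CARD('k)+1..CARD('n)}. lam m < 0) \<and> ?spans"
    have "jac F xs *v Vs$i \<in> span ((\<lambda>j. Vs$j) ` {..i})" for i
    proof -
      have "Vs$i \<in> span (w ` {..i})" using R by (metis atMost_iff image_eqI order_refl span_base)
      then have "jac F xs *v Vs$i \<in> span (w ` {..i})"
        by (rule span_eigenvectors_invariant[OF matrix_vector_mul_linear evec(2)])
      then show ?thesis using R by simp
    qed
    then interpret ghisd_spectrum F xs Vs lam w using R by (intro spectrum) auto
    show "lin_stable (ghisd F) (xs, Vs)" using R by (intro stable_if_span_eq) auto
  qed
qed

end
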